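(* Let $k\in\mathbb{N}$ and $S\subseteq R_{\{0,1\}}^k$. Then $\langle S\rangle_{\mathrm{qpp}} = \big\langle \langle S\rangle_{\mathrm{qpp}}\cap CR^k\big\rangle_{\mathrm{qpp}}$.
   Context: $E_k=\{1,\dots,k\}$. A $k$-sorted relation of arity $n\ge 0$ on $\{0,1\}$ is a subset of $\{0,1\}^n$ (viewed as a predicate) in which each variable is assigned a sort in $E_k$; $R^k_{\{0,1\}}$ is the set of all such relations. $\sigma_\bot$ is the empty $0$-ary relation and $\sigma_=^i$ the binary equality relation on variables of sort $i$. For $S\subseteq R^k_{\{0,1\}}$, $\langle S\rangle_{\mathrm{qpp}}$ is the set of relations definable by formulas built from predicates in $S\cup\{\sigma_\bot,\sigma_=^1,\dots,\sigma_=^k\}$ using conjunction, existential and universal quantification only, where each variable has one sort and is substituted only into positions of that sort. A variable of a relation is dummy if the value of the predicate does not depend on it. Linear equations are expressions $a_1x_1+\dots+a_nx_n=b$ over $\mathbb{Z}_2$ (superscripts denote sorts). A $k$-sorted relation without dummy variables is canonical if, up to the order of its variables, it equals one of: (c1) $x^i=0\lor y^i=1$ ($i\in E_k$); (c2) $x^i=y^i\lor u^j=b$ ($i,j\in E_k$, $b\in\{0,1\}$); (c3) $x^i=y^i\lor u^j=v^j$ with $i\ne j$, or $x^i=y^i\lor y^i=z^i$ ($i\in E_k$); (c4) $x^i+y^i=1$; (c5) $x^i+y^i=u^j+v^j$ ($i,j\in E_k$); (c6) $x^{s_1}+\dots+x^{s_n}=b$ with $n\ge 2$, $s_1,\dots,s_n\in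 E_k$ pairwise distinct, $b\in\{0,1\}$; (c7) $\bigvee_{t=1}^{n}\bigvee_{p=1}^{m_t}(x_p^{s_t}=b_t)$ with $s_1,\dots,s_n\in E_k$ pairwise distinct and $b_1,\dots,b_n\in\{0,1\}$. $CR^k$ denotes the set of all $k$-sorted canonical relations. *)

theory Defs
  imports "HOL-Library.Z2"
begin

datatype srel = SRel (sorts: "nat list") (tuples: "bit list set")

definition srels :: "nat \<Rightarrow> srel set" where
  "srels k = {R. set (sorts R) \<subseteq> {1..k} \<and> (\<forall>t\<in>tuples R. length t = length (sorts R))}"

definition sigma_bot :: srel where
  "sigma_bot = SRel [] {}"

definition sigma_eq :: "nat \<Rightarrow> srel" where
  "sigma_eq i = SRel [i, i] {[c, c] | c. True}"

text \<open>A variable is a pair of its sort and its name, so it has exactly one sort.\<close>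

type_synonym svar = "nat \<times> nat"

text \<open>The relation on the variables \<open>vs\<close> (in this order) given by a condition on assignments that
  depends only on the values of these variables.\<close>

definition rel_on :: "svar list \<Rightarrow> ((svar \<Rightarrow> bit) \<Rightarrow> bool) \<Rightarrow> srel" where
  "rel_on vs P = SRel (map fst vs) {map a vs | a. P a}"

text \<open>\<open>Tru\<close> is the empty conjunction. For \<open>k \<ge> 1\<close> it is redundant, being equivalent to
  \<open>\<exists>x. x = x\<close>; it only matters in the degenerate case \<open>k = 0\<close>, where there are no variables.\<close>

datatype fm =
    Tru
  | Atom srel "svar list"
  | Conj fm fm
  | Exi svar fm
  | Uni svar fm

primrec sat :: "fm \<Rightarrow> (svar \<Rightarrow> bit) \<Rightarrow> bool" where
  "sat Tru a \<longleftrightarrow> True"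
| "sat (Atom R vs) a \<longleftrightarrow> map a vs \<in> tuples R"
| "sat (Conj f g) a \<longleftrightarrow> sat f a \<and> sat g a"
| "sat (Exi v f) a \<longleftrightarrow> (\<exists>c. sat f (a(v := c)))"
| "sat (Uni v f) a \<longleftrightarrow> (\<forall>c. sat f (a(v := c)))"

primrec fv :: "fm \<Rightarrow> svar set" where
  "fv Tru = {}"
| "fv (Atom R vs) = set vs"
| "fv (Conj f g) = fv f \<union> fv g"
| "fv (Exi v f) = fv f - {v}"
| "fv (Uni v f) = fv f - {v}"

text \<open>Formulas over the predicates in \<open>T\<close> with variables of sorts \<open>1, \<dots>, k\<close>; a variable is
  substituted only into positions of its own sort.\<close>

primrec fm_over :: "nat \<Rightarrow> srel set \<Rightarrow> fm \<Rightarrow> bool" where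
  "fm_over k T Tru \<longleftrightarrow> True"
| "fm_over k T (Atom R vs) \<longleftrightarrow> R \<in> T \<and> map fst vs = sorts R"
| "fm_over k T (Conj f g) \<longleftrightarrow> fm_over k T f \<and> fm_over k T g"
| "fm_over k T (Exi v f) \<longleftrightarrow> fst v \<in> {1..k} \<and> fm_over k T f"
| "fm_over k T (Uni v f) \<longleftrightarrow> fst v \<in> {1..k} \<and> fm_over k T f"

definition qpp :: "nat \<Rightarrow> srel set \<Rightarrow> srel set" where
  "qpp k S = {rel_on vs (sat f) | vs f.
     distinct vs \<and> fst ` set vs \<subseteq> {1..k} \<and> fv f \<subseteq> set vs \<and>
     fm_over k (S \<union> {sigma_bot} \<union> sigma_eq ` {1..k}) f}"

definition dummy :: "srel \<Rightarrow> nat \<Rightarrow> bool" where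
  "dummy R p \<longleftrightarrow> p < length (sorts R) \<and>
     (\<forall>t c. length t = length (sorts R) \<longrightarrow> (t[p := c] \<in> tuples R \<longleftrightarrow> t \<in> tuples R))"

text \<open>\<open>canonical_form k V P\<close>: \<open>P\<close> is one of the listed formulas and \<open>V\<close> is its set of variables.
  Differently named variables are distinct; those called $x, y, u, v$ get the names \<open>0, 1, 2, 3\<close>,
  and $z$ in the second form of \<open>c3\<close> gets \<open>2\<close>. The operation \<open>+\<close> on \<open>bit\<close> is addition in
  $\mathbf{Z}_2$.\<close>

inductive canonical_form :: "nat \<Rightarrow> svar set \<Rightarrow> ((svar \<Rightarrow> bit) \<Rightarrow> bool) \<Rightarrow> bool" for k :: nat where
  c1: "i \<in> {1..k} \<Longrightarrow>
    canonical_form k {(i, 0), (i, 1)} (\<lambda>a. a (i, 0) = 0 \<or> a (i, 1) = 1)"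
| c2: "i \<in> {1..k} \<Longrightarrow> j \<in> {1..k} \<Longrightarrow>
    canonical_form k {(i, 0), (i, 1), (j, 2)} (\<lambda>a. a (i, 0) = a (i, 1) \<or> a (j, 2) = b)"
| c3_diff: "i \<in> {1..k} \<Longrightarrow> j \<in> {1..k} \<Longrightarrow> i \<noteq> j \<Longrightarrow>
    canonical_form k {(i, 0), (i, 1), (j, 2), (j, 3)}
      (\<lambda>a. a (i, 0) = a (i, 1) \<or> a (j, 2) = a (j, 3))"
| c3_same: "i \<in> {1..k} \<Longrightarrow>
    canonical_form k {(i, 0), (i, 1), (i, 2)}
      (\<lambda>a. a (i, 0) = a (i, 1) \<or> a (i, 1) = a (i, 2))"
| c4: "i \<in> {1..k} \<Longrightarrow>
    canonical_form k {(i, 0), (i, 1)} (\<lambda>a. a (i, 0) + a (i, 1) = 1)"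
| c5: "i \<in> {1..k} \<Longrightarrow> j \<in> {1..k} \<Longrightarrow>
    canonical_form k {(i, 0), (i, 1), (j, 2), (j, 3)}
      (\<lambda>a. a (i, 0) + a (i, 1) = a (j, 2) + a (j, 3))"
| c6: "(n :: nat) \<ge> 2 \<Longrightarrow> inj_on s {1..n} \<Longrightarrow> s ` {1..n} \<subseteq> {1..k} \<Longrightarrow>
    canonical_form k {(s t, 0) | t. t \<in> {1..n}} (\<lambda>a. (\<Sum>t = 1..n. a (s t, 0)) = b)"
| c7: "(n :: nat) \<ge> 1 \<Longrightarrow> inj_on s {1..n} \<Longrightarrow> s ` {1..n} \<subseteq> {1..k} \<Longrightarrow> (\<And>t. t \<in> {1..n} \<Longrightarrow> m t \<ge> 1) \<Longrightarrow>
    canonical_form k {(s t, p) | t p. t \<in> {1..n} \<and> p \<in> {1..m t}}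
      (\<lambda>a. \<exists>t\<in>{1..n}. \<exists>p\<in>{1..m t}. a (s t, p) = b t)"

text \<open>The order of the variables is arbitrary: \<open>vs\<close> ranges over all enumerations of the variables
  of the form.\<close>

definition CR :: "nat \<Rightarrow> srel set" where
  "CR k = {R \<in> srels k. (\<forall>p. \<not> dummy R p) \<and>
     (\<exists>vs P. distinct vs \<and> canonical_form k (set vs) P \<and> R = rel_on vs P)}"

end

theory Submission
  imports Defs
begin

text \<open>It suffices to separate a relation \<open>P\<close> of the closed set \<open>C\<close> from each tuple \<open>t\<close> outside it by a
  relation generated by the canonical part of \<open>C\<close>. By induction on the arity, every neighbour of
  \<open>t\<close> may be assumed to lie in \<open>P\<close>, and \<open>P\<close> may be enlarged to a maximal relation of \<open>C\<close>
  avoiding \<open>t\<close>. Maximality forces the complement of \<open>P\<close> to be a coset \<open>t + V\<close> of a linear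
  subspace. Universal quantification projects the complement, and the coordinate sets on which the
  projection is a parity condition show that \<open>P\<close> is a disjunction of linear equations, each of
  which lies in \<open>C\<close>. If all these equations have one variable, \<open>P\<close> is a clause. Otherwise the
  disjunction is put together from its members by means of
  \<open>P(x) \<or> A \<longleftrightarrow> (\<exists>x'. P(x') \<and> (x = x' \<or> A))\<close>, and the relations \<open>x = x' \<or> A\<close> reduce to the
  canonical forms \<open>c2\<close> and \<open>c3\<close>.\<close>

section \<open>Definable predicates\<close>

text \<open>The language has no disjunction, and this shapes the proof: a further disjunct
  \<open>A\<close> can be attached only through a definable link \<open>x = x' \<or> A\<close> at a
  variable \<open>x\<close> of what is already built. Clauses with a single sign per sort are not
  built up at all but are canonical as they stand (\<open>c7\<close>). Two literals of opposite sign
  in one sort, or one equation with at least two variables inside a maximal relation, already supply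
  the links to all other disjuncts. The coset in the maximal case comes from the domain having two
  elements: a unary map taking \<open>s v\<close> to \<open>t v\<close> is either constant or the
  translation by \<open>s v + t v\<close>, and the presence of all neighbours of \<open>t\<close> in
  the relation excludes constant coordinates. Canonical forms have fixed variable names and no dummy
  variables, so the constructions are carried out with predicates on assignments and moved to those
  names by injective renamings.\<close>

definition depends_only :: "svar set \<Rightarrow> ((svar \<Rightarrow> bit) \<Rightarrow> bool) \<Rightarrow> bool" where
  "depends_only W P \<longleftrightarrow> (\<forall>a b. (\<forall>v\<in>W. a v = b v) \<longrightarrow> P a = P b)"

text \<open>Predicates on assignments are insensitive to the order of variables and to dummy
  variables. Only \<open>qppE\<close>, \<open>qpp_definable\<close> and \<open>qpp_rel_on\<close>
  translate between them and relations.\<close>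

definition definable :: "nat \<Rightarrow> srel set \<Rightarrow> ((svar \<Rightarrow> bit) \<Rightarrow> bool) \<Rightarrow> bool" where
  "definable k T P \<longleftrightarrow> (\<exists>f. fm_over k (T \<union> {sigma_bot} \<union> sigma_eq ` {1..k}) f \<and> sat f = P)"

lemma depends_onlyD: "depends_only W P \<Longrightarrow> (\<And>v. v \<in> W \<Longrightarrow> a v = b v) \<Longrightarrow> P a = P b"
  unfolding depends_only_def by blast

lemma depends_only_mono: "depends_only W P \<Longrightarrow> W \<subseteq> W' \<Longrightarrow> depends_only W' P"
  unfolding depends_only_def by blast

lemma depends_only_upd: "depends_only W P \<Longrightarrow> v \<notin> W \<Longrightarrow> P (a(v := c)) = P a"
  by (rule depends_onlyD[of W]) auto

lemma finite_fv: "finite (fv f)"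
  by (induction f) auto

lemma depends_only_sat: "depends_only (fv f) (sat f)"
proof (induction f)
  case (Atom R vs)
  have "map a vs = map b vs" if "\<forall>v\<in>set vs. a v = b v" for a b :: "svar \<Rightarrow> bit"
    using that by simp
  then show ?case unfolding depends_only_def by (metis fv.simps(2) sat.simps(2))
next
  case (Conj f g)
  then show ?case unfolding depends_only_def by (metis UnCI fv.simps(3) sat.simps(3))
next
  case (Exi v f)
  have "sat f (a(v := c)) = sat f (b(v := c))" if "\<forall>w\<in>fv f - {v}. a w = b w" for a b c
    by (rule depends_onlyD[OF Exi]) (use that in auto)
  then show ?case unfolding depends_only_def fv.simps sat.simps by blast
next
  case (Uni v f)
  have "sat f (a(v := c)) = sat f (b(v := c))" if "\<forall>w\<in>fv f - {v}. a w = b w" for a b c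
    by (rule depends_onlyD[OF Uni]) (use that in auto)
  then show ?case unfolding depends_only_def fv.simps sat.simps by blast
qed (simp add: depends_only_def)

lemma definable_finite_depends_only: "definable k T P \<Longrightarrow> \<exists>F. finite F \<and> depends_only F P"
  unfolding definable_def using finite_fv depends_only_sat by blast

lemma fresh_var: "finite (F :: svar set) \<Longrightarrow> \<exists>v. fst v = i \<and> v \<notin> F"
proof -
  assume F: "finite F"
  have "infinite ((\<lambda>n. (i, n)) ` (UNIV :: nat set))"
    by (subst finite_image_iff) (auto simp: inj_on_def)
  then obtain v where "v \<in> (\<lambda>n. (i, n)) ` (UNIV :: nat set)" "v \<notin> F"
    using F by (meson finite_subset subsetI)
  then show ?thesis by (intro exI[of _ v]) auto
qed

lemma definable_cong: "definable k T P \<Longrightarrow> (\<And>a. P a = Q a) \<Longrightarrow> definable k T Q"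
  using ext[of P Q] by simp

lemma definable_True: "definable k T (\<lambda>a. True)"
  unfolding definable_def by (intro exI[of _ Tru]) auto

lemma definable_False: "definable k T (\<lambda>a. False)"
  unfolding definable_def by (intro exI[of _ "Atom sigma_bot []"]) (auto simp: sigma_bot_def)

lemma definable_eq:
  assumes "fst p = fst q" "fst p \<in> {1..k}"
  shows "definable k T (\<lambda>a. a p = a q)"
  unfolding definable_def
  by (rule exI[of _ "Atom (sigma_eq (fst p)) [p, q]"]) (use assms in \<open>auto simp: sigma_eq_def\<close>)

lemma definable_Atom: "R \<in> T \<Longrightarrow> map fst vs = sorts R \<Longrightarrow> definable k T (\<lambda>a. map a vs \<in> tuples R)"
  unfolding definable_def by (intro exI[of _ "Atom R vs"]) auto

lemma definable_conj:
  assumes "definable k T P" "definable k T Q" shows "definable k T (\<lambda>a. P a \<and> Q a)"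
proof -
  obtain f g where "fm_over k (T \<union> {sigma_bot} \<union> sigma_eq ` {1..k}) f" "sat f = P"
    "fm_over k (T \<union> {sigma_bot} \<union> sigma_eq ` {1..k}) g" "sat g = Q"
    using assms unfolding definable_def by blast
  then show ?thesis unfolding definable_def by (intro exI[of _ "Conj f g"]) auto
qed

lemma definable_ex:
  assumes "definable k T P" "fst v \<in> {1..k}" shows "definable k T (\<lambda>a. \<exists>c. P (a(v := c)))"
proof -
  obtain f where "fm_over k (T \<union> {sigma_bot} \<union> sigma_eq ` {1..k}) f" "sat f = P"
    using assms unfolding definable_def by blast
  with assms(2) show ?thesis unfolding definable_def by (intro exI[of _ "Exi v f"]) (auto simp: fun_eq_iff)
qed

lemma definable_all:
  assumes "definable k T P" "fst v \<in> {1..k}" shows "definable k T (\<lambda>a. \<forall>c. P (a(v := c)))"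
proof -
  obtain f where "fm_over k (T \<union> {sigma_bot} \<union> sigma_eq ` {1..k}) f" "sat f = P"
    using assms unfolding definable_def by blast
  with assms(2) show ?thesis unfolding definable_def by (intro exI[of _ "Uni v f"]) (auto simp: fun_eq_iff)
qed

lemma definable_conjs:
  assumes "finite J" "\<And>j. j \<in> J \<Longrightarrow> definable k T (P j)" shows "definable k T (\<lambda>a. \<forall>j\<in>J. P j a)"
  using assms
proof (induction J rule: finite_induct)
  case empty then show ?case by (simp add: definable_True)
next
  case (insert j J)
  have "definable k T (\<lambda>a. P j a \<and> (\<forall>j\<in>J. P j a))" using insert by (intro definable_conj) auto
  then show ?case by (rule definable_cong) auto
qed

lemma agree_insert:
  "(\<exists>c. \<forall>v. v \<notin> F \<longrightarrow> b v = (a(w := c)) v) \<longleftrightarrow> (\<forall>v. v \<notin> insert w F \<longrightarrow> b v = a v)"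
proof
  assume "\<forall>v. v \<notin> insert w F \<longrightarrow> b v = a v"
  then show "\<exists>c. \<forall>v. v \<notin> F \<longrightarrow> b v = (a(w := c)) v" by (intro exI[of _ "b w"]) auto
qed (metis fun_upd_apply insert_iff)

lemma definable_exs:
  assumes "finite F" "fst ` F \<subseteq> {1..k}" "definable k T P"
  shows "definable k T (\<lambda>a. \<exists>b. (\<forall>v. v \<notin> F \<longrightarrow> b v = a v) \<and> P b)"
  using assms
proof (induction F rule: finite_induct)
  case empty
  have "(\<forall>v. b v = a v) \<longleftrightarrow> b = a" for a b :: "svar \<Rightarrow> bit"
    by (rule fun_eq_iff[symmetric])
  with empty show ?case by (simp del: split_paired_All)
next
  case (insert w F)
  have "definable k T (\<lambda>a. \<exists>c. \<exists>b. (\<forall>v. v \<notin> F \<longrightarrow> b v = (a(w := c)) v) \<and> P b)"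
    using insert by (intro definable_ex[where P = "\<lambda>a. \<exists>b. (\<forall>v. v \<notin> F \<longrightarrow> b v = a v) \<and> P b"]) auto
  then show ?case
  proof (rule definable_cong)
    fix a show "(\<exists>c b. (\<forall>v. v \<notin> F \<longrightarrow> b v = (a(w := c)) v) \<and> P b)
      = (\<exists>b. (\<forall>v. v \<notin> insert w F \<longrightarrow> b v = a v) \<and> P b)"
      using agree_insert[of F _ a w] by blast
  qed
qed

lemma definable_alls:
  assumes "finite F" "fst ` F \<subseteq> {1..k}" "definable k T P"
  shows "definable k T (\<lambda>a. \<forall>b. (\<forall>v. v \<notin> F \<longrightarrow> b v = a v) \<longrightarrow> P b)"
  using assms
proof (induction F rule: finite_induct)
  case empty
  have "(\<forall>v. b v = a v) \<longleftrightarrow> b = a" for a b :: "svar \<Rightarrow> bit"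
    by (rule fun_eq_iff[symmetric])
  with empty show ?case by (simp del: split_paired_All)
next
  case (insert w F)
  have "definable k T (\<lambda>a. \<forall>c. \<forall>b. (\<forall>v. v \<notin> F \<longrightarrow> b v = (a(w := c)) v) \<longrightarrow> P b)"
    using insert by (intro definable_all[where P = "\<lambda>a. \<forall>b. (\<forall>v. v \<notin> F \<longrightarrow> b v = a v) \<longrightarrow> P b"]) auto
  then show ?case
  proof (rule definable_cong)
    fix a show "(\<forall>c b. (\<forall>v. v \<notin> F \<longrightarrow> b v = (a(w := c)) v) \<longrightarrow> P b)
      = (\<forall>b. (\<forall>v. v \<notin> insert w F \<longrightarrow> b v = a v) \<longrightarrow> P b)"
      using agree_insert[of F _ a w] by blast
  qed
qed

section \<open>Sort-preserving renaming and identification of variables\<close>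

lemma definable_rename_sat:
  assumes "fm_over k (T \<union> {sigma_bot} \<union> sigma_eq ` {1..k}) f" "\<And>v. fst (\<rho> v) = fst v"
  shows "definable k T (\<lambda>a. sat f (\<lambda>v. a (\<rho> v)))"
  using assms
proof (induction f arbitrary: \<rho>)
  case Tru
  then show ?case by (simp add: definable_True)
next
  case (Atom R vs)
  then show ?case unfolding definable_def
    by (intro exI[of _ "Atom R (map \<rho> vs)"]) (auto simp: comp_def)
next
  case (Conj f g)
  then show ?case by (simp add: definable_conj)
next
  case (Exi v f)
  \<comment> \<open>The bound variable is sent to a fresh \<open>w\<close> of its sort; otherwise
    \<open>\<rho>\<close> could let the quantifier capture the image of a free variable.\<close>
  obtain w where w: "fst w = fst v" "w \<notin> \<rho> ` fv f"
    using fresh_var finite_fv by (metis finite_imageI)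
  have "definable k T (\<lambda>a. sat f (\<lambda>x. a ((\<rho>(v := w)) x)))"
    using Exi w by (intro Exi.IH) auto
  then have "definable k T (\<lambda>a. \<exists>c. sat f (\<lambda>x. (a(w := c)) ((\<rho>(v := w)) x)))"
    using Exi w by (intro definable_ex[where P = "\<lambda>a. sat f (\<lambda>x. a ((\<rho>(v := w)) x))"]) auto
  then show ?case
  proof (rule definable_cong)
    fix a :: "svar \<Rightarrow> bit"
    have "sat f (\<lambda>x. (a(w := c)) ((\<rho>(v := w)) x)) = sat f ((\<lambda>x. a (\<rho> x))(v := c))" for c
      by (rule depends_onlyD[OF depends_only_sat]) (use w in auto)
    then show "(\<exists>c. sat f (\<lambda>x. (a(w := c)) ((\<rho>(v := w)) x))) = sat (Exi v f) (\<lambda>v. a (\<rho> v))"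
      by simp
  qed
next
  case (Uni v f)
  obtain w where w: "fst w = fst v" "w \<notin> \<rho> ` fv f"
    using fresh_var finite_fv by (metis finite_imageI)
  have "definable k T (\<lambda>a. sat f (\<lambda>x. a ((\<rho>(v := w)) x)))"
    using Uni w by (intro Uni.IH) auto
  then have "definable k T (\<lambda>a. \<forall>c. sat f (\<lambda>x. (a(w := c)) ((\<rho>(v := w)) x)))"
    using Uni w by (intro definable_all[where P = "\<lambda>a. sat f (\<lambda>x. a ((\<rho>(v := w)) x))"]) auto
  then show ?case
  proof (rule definable_cong)
    fix a :: "svar \<Rightarrow> bit"
    have "sat f (\<lambda>x. (a(w := c)) ((\<rho>(v := w)) x)) = sat f ((\<lambda>x. a (\<rho> x))(v := c))" for c
      by (rule depends_onlyD[OF depends_only_sat]) (use w in auto)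
    then show "(\<forall>c. sat f (\<lambda>x. (a(w := c)) ((\<rho>(v := w)) x))) = sat (Uni v f) (\<lambda>v. a (\<rho> v))"
      by simp
  qed
qed

lemma definable_rename:
  assumes "definable k T P" "\<And>v. fst (\<rho> v) = fst v"
  shows "definable k T (\<lambda>a. P (\<lambda>v. a (\<rho> v)))"
proof -
  obtain f where "fm_over k (T \<union> {sigma_bot} \<union> sigma_eq ` {1..k}) f" "sat f = P"
    using assms(1) unfolding definable_def by blast
  then show ?thesis using definable_rename_sat assms(2) by metis
qed

lemma definable_subst:
  assumes "definable k T P" "fst w = fst v"
  shows "definable k T (\<lambda>a. P (a(v := a w)))"
proof -
  have "definable k T (\<lambda>a. P (\<lambda>x. a ((id(v := w)) x)))"
    by (rule definable_rename[where \<rho> = "id(v := w)", OF assms(1)]) (use assms(2) in auto)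
  then show ?thesis
  proof (rule definable_cong)
    fix a :: "svar \<Rightarrow> bit"
    have "(\<lambda>x. a ((id(v := w)) x)) = a(v := a w)" by auto
    then show "P (\<lambda>x. a ((id(v := w)) x)) = P (a(v := a w))" by simp
  qed
qed

section \<open>Passage between definable predicates and the relations in \<open>qpp\<close>\<close>

lemma sigma_in_srels: "sigma_bot \<in> srels k" "i \<in> {1..k} \<Longrightarrow> sigma_eq i \<in> srels k"
  by (auto simp: srels_def sigma_bot_def sigma_eq_def)

lemma fv_sorts:
  assumes "T \<subseteq> srels k" "fm_over k (T \<union> {sigma_bot} \<union> sigma_eq ` {1..k}) f"
  shows "fst ` fv f \<subseteq> {1..k}"
  using assms(2)
proof (induction f)
  case (Atom R vs)
  then have R: "R \<in> srels k" "map fst vs = sorts R" using assms(1) sigma_in_srels by auto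
  have "fst ` set vs = set (sorts R)" by (metis R(2) list.set_map)
  with R show ?case by (simp add: srels_def)
qed auto

text \<open>A variable that is free in the formula but irrelevant to its value can be bound by an
  existential quantifier without changing the predicate. Repeating this achieves the syntactic
  condition on \<open>fv\<close> that \<open>qpp\<close> demands.\<close>

lemma definable_fv:
  assumes "T \<subseteq> srels k" "definable k T P" "depends_only V P"
  shows "\<exists>f. fm_over k (T \<union> {sigma_bot} \<union> sigma_eq ` {1..k}) f \<and> sat f = P \<and> fv f \<subseteq> V"
proof -
  define T' where "T' = T \<union> {sigma_bot} \<union> sigma_eq ` {1..k}"
  have "\<exists>g. fm_over k T' g \<and> sat g = P \<and> fv g \<subseteq> V"
    if "fm_over k T' f" "sat f = P" "card (fv f - V) = n" for f n
    using that
  proof (induction n arbitrary: f)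
    case 0
    then show ?case using finite_fv[of f] by (intro exI[of _ f]) auto
  next
    case (Suc n)
    then obtain v where v: "v \<in> fv f" "v \<notin> V"
      by (metis Diff_iff card.empty equals0I nat.distinct(1))
    have "fst v \<in> {1..k}" using fv_sorts[OF assms(1) Suc.prems(1)[unfolded T'_def]] v by blast
    moreover have "sat (Exi v f) = P"
      using Suc.prems(2) depends_only_upd[OF assms(3) v(2)] by (auto simp: fun_eq_iff)
    moreover have "card (fv (Exi v f) - V) = n"
    proof -
      have "fv (Exi v f) - V = fv f - V - {v}" by auto
      with Suc.prems(3) v finite_fv[of f] show ?thesis by simp
    qed
    ultimately show ?case using Suc.prems(1) by (intro Suc.IH[of "Exi v f"]) auto
  qed
  with assms(2) show ?thesis unfolding definable_def T'_def by blast
qed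

lemma map_in_rel_on:
  assumes "depends_only (set vs) P" shows "map a vs \<in> tuples (rel_on vs P) \<longleftrightarrow> P a"
  using assms unfolding rel_on_def depends_only_def by (auto simp: map_eq_conv)

lemma qpp_rel_on:
  assumes "T \<subseteq> srels k" "definable k T P" "depends_only (set vs) P" "distinct vs" "fst ` set vs \<subseteq> {1..k}"
  shows "rel_on vs P \<in> qpp k T"
  using definable_fv[OF assms(1-3)] assms(4,5) unfolding qpp_def by blast

lemma rel_on_srels: "fst ` set vs \<subseteq> {1..k} \<Longrightarrow> rel_on vs P \<in> srels k"
  by (auto simp: rel_on_def srels_def)

lemma qpp_srels: "qpp k T \<subseteq> srels k"
  using rel_on_srels unfolding qpp_def by blast

text \<open>The defining formula uses the distinct variables \<open>vs\<close>, so a renaming from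
  \<open>vs\<close> to \<open>ws\<close> exists even when \<open>ws\<close> has repetitions, as the
  arguments of an atom may have.\<close>

lemma qpp_definable:
  assumes "R \<in> qpp k T" "map fst ws = sorts R"
  shows "definable k T (\<lambda>a. map a ws \<in> tuples R)"
proof -
  obtain vs f where R: "R = rel_on vs (sat f)" "distinct vs" "fv f \<subseteq> set vs"
    "fm_over k (T \<union> {sigma_bot} \<union> sigma_eq ` {1..k}) f"
    using assms(1) unfolding qpp_def by blast
  have s: "map fst ws = map fst vs" using assms(2) R(1) by (simp add: rel_on_def)
  then have len: "length ws = length vs" by (metis length_map)
  define \<rho> where "\<rho> v = (case map_of (zip vs ws) v of Some w \<Rightarrow> w | None \<Rightarrow> v)" for v
  have m: "map \<rho> vs = ws"
    by (rule nth_equalityI) (use len R(2) in \<open>auto simp: \<rho>_def map_of_zip_nth\<close>)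
  have "fst (\<rho> v) = fst v" for v
  proof (cases "v \<in> set vs")
    case True
    then obtain n where n: "n < length vs" "v = vs ! n" by (metis in_set_conv_nth)
    then have "\<rho> v = ws ! n" using m by (metis nth_map)
    with n s len show ?thesis by (metis nth_map)
  next
    case False
    then show ?thesis using len by (auto simp: \<rho>_def split: option.splits dest: map_of_SomeD set_zip_leftD)
  qed
  then have "definable k T (\<lambda>a. sat f (\<lambda>v. a (\<rho> v)))" using R(4) by (intro definable_rename_sat)
  then show ?thesis
  proof (rule definable_cong)
    fix a :: "svar \<Rightarrow> bit"
    have "map a ws = map (\<lambda>v. a (\<rho> v)) vs" unfolding m[symmetric] by simp
    then show "sat f (\<lambda>v. a (\<rho> v)) = (map a ws \<in> tuples R)"
      using map_in_rel_on[OF depends_only_mono[OF depends_only_sat R(3)]] R(1) by metis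
  qed
qed

lemma definable_qpp_idem: "definable k (qpp k T) P \<Longrightarrow> definable k T P"
proof -
  have "definable k T (sat f)" if "fm_over k (qpp k T \<union> {sigma_bot} \<union> sigma_eq ` {1..k}) f" for f
    using that
  proof (induction f)
    case (Atom R vs)
    then consider "R \<in> qpp k T" | "R \<in> {sigma_bot} \<union> sigma_eq ` {1..k}" by auto
    then have "definable k T (\<lambda>a. map a vs \<in> tuples R)"
    proof cases
      case 2
      with Atom show ?thesis unfolding definable_def by (intro exI[of _ "Atom R vs"]) auto
    qed (use Atom qpp_definable in auto)
    then show ?case by (rule definable_cong) auto
  next
    case Tru
    show ?case by (rule definable_cong[OF definable_True]) auto
  next
    case (Conj f g)
    then have "definable k T (sat f)" "definable k T (sat g)" by auto
    then show ?case by (rule definable_cong[OF definable_conj]) auto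
  next
    case (Exi v f)
    then have "definable k T (sat f)" "fst v \<in> {1..k}" by auto
    then show ?case by (rule definable_cong[OF definable_ex]) auto
  next
    case (Uni v f)
    then have "definable k T (sat f)" "fst v \<in> {1..k}" by auto
    then show ?case by (rule definable_cong[OF definable_all]) auto
  qed
  then show "definable k (qpp k T) P \<Longrightarrow> definable k T P" unfolding definable_def[of k "qpp k T"] by auto
qed

section \<open>Disjunctions of definable predicates\<close>

text \<open>Only the sorts matter: one instance with four distinct variables yields all others by
  renaming (\<open>eq_or_eqI\<close>). This is the link between two sorts along which disjunctions
  are transported.\<close>

definition eq_or_eq :: "nat \<Rightarrow> srel set \<Rightarrow> nat \<Rightarrow> nat \<Rightarrow> bool" where
  "eq_or_eq k T i j \<longleftrightarrow> (\<forall>u u' v v'. fst u = i \<longrightarrow> fst u' = i \<longrightarrow> fst v = j \<longrightarrow> fst v' = j \<longrightarrow>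
     definable k T (\<lambda>a. a u = a u' \<or> a v = a v'))"

definition eq_or :: "nat \<Rightarrow> srel set \<Rightarrow> nat \<Rightarrow> ((svar \<Rightarrow> bit) \<Rightarrow> bool) \<Rightarrow> bool" where
  "eq_or k T i A \<longleftrightarrow> (\<forall>u u'. fst u = i \<longrightarrow> fst u' = i \<longrightarrow> definable k T (\<lambda>a. a u = a u' \<or> A a))"

text \<open>Both new values are read from the original assignment, so the substitution is
  simultaneous and can swap two variables.\<close>

lemma definable_subst2:
  assumes "definable k T P" "fst w = fst v" "fst w' = fst v'"
  shows "definable k T (\<lambda>a. P (a(v := a w, v' := a w')))"
proof -
  have "definable k T (\<lambda>a. P (\<lambda>x. a ((id(v := w, v' := w')) x)))"
    by (rule definable_rename[where \<rho> = "id(v := w, v' := w')", OF assms(1)]) (use assms(2,3) in auto)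
  then show ?thesis
  proof (rule definable_cong)
    fix a :: "svar \<Rightarrow> bit"
    have "(\<lambda>x. a ((id(v := w, v' := w')) x)) = a(v := a w, v' := a w')" by auto
    then show "P (\<lambda>x. a ((id(v := w, v' := w')) x)) = P (a(v := a w, v' := a w'))" by simp
  qed
qed

lemma eq_orI:
  assumes "definable k T (\<lambda>a. a u = a u' \<or> A a)" "depends_only F A" "u \<notin> F" "u' \<notin> F" "u \<noteq> u'" "fst u = i" "fst u' = i"
  shows "eq_or k T i A"
  unfolding eq_or_def
proof (intro allI impI)
  fix w w' :: svar assume "fst w = i" "fst w' = i"
  then have "definable k T (\<lambda>a. (\<lambda>a. a u = a u' \<or> A a) (a(u := a w, u' := a w')))"
    using assms by (intro definable_subst2) auto
  then show "definable k T (\<lambda>a. a w = a w' \<or> A a)"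
  proof (rule definable_cong)
    fix a :: "svar \<Rightarrow> bit"
    have "A (a(u := a w, u' := a w')) = A a" by (rule depends_onlyD[OF assms(2)]) (use assms in auto)
    with assms(5) show "((a(u := a w, u' := a w')) u = (a(u := a w, u' := a w')) u' \<or> A (a(u := a w, u' := a w')))
      = (a w = a w' \<or> A a)" by simp
  qed
qed

lemma eq_orD: "eq_or k T i A \<Longrightarrow> fst u = i \<Longrightarrow> fst u' = i \<Longrightarrow> definable k T (\<lambda>a. a u = a u' \<or> A a)"
  unfolding eq_or_def by blast

lemma eq_or_eqD: "eq_or_eq k T i j \<Longrightarrow> fst u = i \<Longrightarrow> fst u' = i \<Longrightarrow> fst v = j \<Longrightarrow> fst v' = j \<Longrightarrow>
  definable k T (\<lambda>a. a u = a u' \<or> a v = a v')"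
  unfolding eq_or_eq_def by blast

lemma eq_or_eq_sym:
  assumes "eq_or_eq k T i j" shows "eq_or_eq k T j i"
  unfolding eq_or_eq_def
proof (intro allI impI)
  fix u u' v v' :: svar assume "fst u = j" "fst u' = j" "fst v = i" "fst v' = i"
  from eq_or_eqD[OF assms this(3,4,1,2)] show "definable k T (\<lambda>a. a u = a u' \<or> a v = a v')"
    by (simp only: disj_commute)
qed

lemma eq_or_eq_imp_eq_or: "eq_or_eq k T i j \<Longrightarrow> fst v = j \<Longrightarrow> fst v' = j \<Longrightarrow> eq_or k T i (\<lambda>a. a v = a v')"
  unfolding eq_or_def by (intro allI impI) (rule eq_or_eqD)

lemma eq_or_eqI:
  assumes "definable k T (\<lambda>a. a u = a u' \<or> a v = a v')" "u \<noteq> u'" "v \<noteq> v'" "{u, u'} \<inter> {v, v'} = {}"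
    "fst u = i" "fst u' = i" "fst v = j" "fst v' = j"
  shows "eq_or_eq k T i j"
  unfolding eq_or_eq_def
proof (intro allI impI)
  fix w w' x x' :: svar assume s: "fst w = i" "fst w' = i" "fst x = j" "fst x' = j"
  let ?\<rho> = "id(u := w, u' := w', v := x, v' := x')"
  have "definable k T (\<lambda>a. (\<lambda>a. a u = a u' \<or> a v = a v') (\<lambda>y. a (?\<rho> y)))"
    by (rule definable_rename[where \<rho> = ?\<rho>, OF assms(1)]) (use s assms in auto)
  then show "definable k T (\<lambda>a. a w = a w' \<or> a x = a x')"
    by (rule definable_cong) (use assms in auto)
qed

text \<open>If \<open>A\<close> fails, the quantified copy \<open>v'\<close> is forced to equal
  \<open>v\<close>, leaving \<open>P\<close>. If \<open>A\<close> holds, \<open>surj\<close>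
  provides a value of the copy that satisfies \<open>P\<close>.\<close>

lemma definable_disj:
  assumes P: "definable k T P" and E: "eq_or k T (fst v) A" and A: "finite F" "depends_only F A"
    and v: "fst v \<in> {1..k}" and surj: "\<And>a. \<exists>c. P (a(v := c))"
  shows "definable k T (\<lambda>a. P a \<or> A a)"
proof -
  obtain G where G: "finite G" "depends_only G P" using definable_finite_depends_only[OF P] by auto
  obtain v' where v': "fst v' = fst v" "v' \<notin> insert v (F \<union> G)"
    using fresh_var[of "insert v (F \<union> G)" "fst v"] A(1) G(1) by blast
  have "definable k T (\<lambda>a. P (a(v := a v')) \<and> (a v = a v' \<or> A a))"
    using v' by (intro definable_conj definable_subst P eq_orD[OF E]) auto
  from definable_ex[OF this, of v'] have
    "definable k T (\<lambda>a. \<exists>c. P ((a(v' := c))(v := (a(v' := c)) v')) \<and>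
      ((a(v' := c)) v = (a(v' := c)) v' \<or> A (a(v' := c))))"
    using v v' by simp
  then show ?thesis
  proof (rule definable_cong)
    fix a :: "svar \<Rightarrow> bit"
    have e1: "P ((a(v' := c))(v := (a(v' := c)) v')) = P (a(v := c))" for c
      by (rule depends_onlyD[OF G(2)]) (use v' in auto)
    have e2: "A (a(v' := c)) = A a" for c using v' by (intro depends_only_upd[OF A(2)]) auto
    have e3: "(a(v' := c)) v = a v" for c using v' by auto
    show "(\<exists>c. P ((a(v' := c))(v := (a(v' := c)) v')) \<and>
      ((a(v' := c)) v = (a(v' := c)) v' \<or> A (a(v' := c)))) = (P a \<or> A a)"
      unfolding e1 e2 e3 using surj[of a] by (cases "A a") auto
  qed
qed

text \<open>Disjuncts are attached one at a time, each at its own variable of \<open>X\<close>.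
  Enlarging the disjunction preserves its solvability in every variable of \<open>X\<close>, so
  \<open>definable_disj\<close> stays applicable.\<close>

lemma definable_disjs:
  assumes "finite J" "definable k T P" "\<And>a v. v \<in> X \<Longrightarrow> \<exists>c. P (a(v := c))" "fst ` X \<subseteq> {1..k}"
    "\<And>j. j \<in> J \<Longrightarrow> \<exists>v\<in>X. eq_or k T (fst v) (A j)" "\<And>j. j \<in> J \<Longrightarrow> depends_only F (A j)" "finite F"
  shows "definable k T (\<lambda>a. P a \<or> (\<exists>j\<in>J. A j a))"
  using assms
proof (induction J rule: finite_induct)
  case (insert j J)
  obtain v where v: "v \<in> X" "eq_or k T (fst v) (A j)" using insert.prems(4) by blast
  have "definable k T (\<lambda>a. (P a \<or> (\<exists>j\<in>J. A j a)) \<or> A j a)"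
  proof (rule definable_disj)
    show "definable k T (\<lambda>a. P a \<or> (\<exists>j\<in>J. A j a))" using insert by blast
    show "eq_or k T (fst v) (A j)" "finite F" "depends_only F (A j)" "fst v \<in> {1..k}" using v insert.prems by auto
    show "\<exists>c. P (a(v := c)) \<or> (\<exists>j\<in>J. A j (a(v := c)))" for a using insert.prems(2)[OF v(1)] by blast
  qed
  then show ?case by (rule definable_cong) auto
qed simp

section \<open>Links to linear equations\<close>

lemma bit_neq_iff: "x \<noteq> y \<longleftrightarrow> x = y + 1" for x y :: bit
  by (cases x; cases y) auto

lemma sum_upd:
  fixes a :: "'v \<Rightarrow> bit"
  assumes "finite X" "v \<in> X" shows "sum (a(v := c)) X = sum a X + a v + c"
proof -
  have "sum (a(v := c)) X = c + sum (a(v := c)) (X - {v})" using sum.remove[OF assms, of "a(v := c)"] by simp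
  also have "sum (a(v := c)) (X - {v}) = sum a (X - {v})" by (rule sum.cong) auto
  finally have 1: "sum (a(v := c)) X = c + sum a (X - {v})" .
  have "sum a X = a v + sum a (X - {v})" by (rule sum.remove[OF assms])
  with 1 show ?thesis by (cases "a v"; cases c; cases "sum a (X - {v})") auto
qed

lemma sum_upd_notin: "v \<notin> X \<Longrightarrow> sum (a(v := c)) X = sum a X"
  by (rule sum.cong) auto

lemma sum_solve:
  fixes a :: "'v \<Rightarrow> bit"
  assumes "finite X" "v \<in> X" shows "\<exists>c. sum (a(v := c)) X = b"
  by (rule exI[of _ "b + sum a X + a v"], subst sum_upd[OF assms])
    (cases "a v"; cases b; cases "sum a X"; simp)

lemma depends_only_sum: "depends_only X (\<lambda>a. sum a X = b)"
  unfolding depends_only_def by (metis sum.cong)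

text \<open>Two copies of the relation, with \<open>q\<close> and with a fresh \<open>q'\<close>,
  share all other variables. Quantifying \<open>r\<close> existentially makes the first equation
  solvable, and both together then say \<open>q = q'\<close>.\<close>

lemma eq_or_lin_imp_eq_or_eq:
  assumes E: "eq_or k T i (\<lambda>a. sum a Q = b)" and Q: "finite Q" "fst ` Q \<subseteq> {1..k}"
    and qr: "q \<in> Q" "r \<in> Q" "q \<noteq> r"
  shows "eq_or_eq k T i (fst q)"
proof -
  obtain u where u: "fst u = i" "u \<notin> Q" using fresh_var Q by blast
  obtain u' where u': "fst u' = i" "u' \<notin> insert u Q" using fresh_var[of "insert u Q"] Q by blast
  obtain q' where q': "fst q' = fst q" "q' \<notin> insert u' (insert u Q)"
    using fresh_var[of "insert u' (insert u Q)"] Q by blast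
  let ?F = "\<lambda>a. a u = a u' \<or> sum a Q = b"
  have F: "definable k T ?F" by (rule eq_orD[OF E u(1) u'(1)])
  have "definable k T (\<lambda>a. ?F a \<and> ?F (a(q := a q')))"
    by (rule definable_conj[OF F definable_subst[OF F q'(1)]])
  from definable_ex[OF this, of r] have
    "definable k T (\<lambda>a. \<exists>c. ?F (a(r := c)) \<and> ?F ((a(r := c))(q := (a(r := c)) q')))"
    using qr Q by blast
  then have "definable k T (\<lambda>a. a u = a u' \<or> a q = a q')"
  proof (rule definable_cong)
    fix a :: "svar \<Rightarrow> bit"
    have ne: "u \<noteq> r" "u' \<noteq> r" "q' \<noteq> r" "u \<noteq> q" "u' \<noteq> q" "q \<noteq> r" using u u' q' qr by auto
    have s: "sum ((a(r := c))(q := a q')) Q = sum (a(r := c)) Q + a q + a q'" for c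
      using sum_upd[OF Q(1) qr(1), of "a(r := c)" "a q'"] ne by simp
    have e1: "?F (a(r := c)) \<longleftrightarrow> a u = a u' \<or> sum (a(r := c)) Q = b" for c
      using ne by simp
    have e2: "?F ((a(r := c))(q := (a(r := c)) q')) \<longleftrightarrow> a u = a u' \<or> sum (a(r := c)) Q + a q + a q' = b" for c
      using ne s by simp
    obtain c where c: "sum (a(r := c)) Q = b" using sum_solve[OF Q(1) qr(2)] by blast
    have e3: "x = b \<and> x + a q + a q' = b \<longleftrightarrow> x = b \<and> a q = a q'" for x
      by (cases "a q"; cases "a q'"; cases x; auto)
    show "(\<exists>c. ?F (a(r := c)) \<and> ?F ((a(r := c))(q := (a(r := c)) q'))) = (a u = a u' \<or> a q = a q')"
      unfolding e1 e2 using c e3 by blast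
  qed
  then show ?thesis
    by (rule eq_or_eqI) (use u u' q' qr in auto)
qed

text \<open>The roles in \<open>definable_disj\<close> are reversed: the equation is the base,
  solvable in \<open>q\<close>, and \<open>a u = a u'\<close> is the disjunct attached at
  \<open>q\<close>.\<close>

lemma eq_or_eq_imp_eq_or_lin:
  assumes "eq_or_eq k T i (fst q)" "definable k T (\<lambda>a. sum a Q = b)" "finite Q" "fst ` Q \<subseteq> {1..k}" "q \<in> Q"
  shows "eq_or k T i (\<lambda>a. sum a Q = b)"
  unfolding eq_or_def
proof (intro allI impI)
  fix u u' :: svar assume u: "fst u = i" "fst u' = i"
  have "definable k T (\<lambda>a. sum a Q = b \<or> a u = a u')"
  proof (rule definable_disj[where F = "{u, u'}"])
    show "eq_or k T (fst q) (\<lambda>a. a u = a u')" using eq_or_eq_imp_eq_or[OF eq_or_eq_sym[OF assms(1)]] u by blast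
    show "\<exists>c. sum (a(q := c)) Q = b" for a by (rule sum_solve[OF assms(3,5)])
  qed (use assms in \<open>auto simp: depends_only_def\<close>)
  then show "definable k T (\<lambda>a. a u = a u' \<or> sum a Q = b)" by (rule definable_cong) auto
qed

text \<open>The path of length three comes from \<open>\<exists>w. (x = y \<or> y = w) \<and> (w = u \<or> u = v)\<close>; swapping its last
  two vertices separates the two equations.\<close>

lemma eq_or_eq_of_path:
  assumes "\<And>x y z. fst x = i \<Longrightarrow> fst y = i \<Longrightarrow> fst z = i \<Longrightarrow> definable k T (\<lambda>a. a x = a y \<or> a y = a z)"
    "i \<in> {1..k}"
  shows "eq_or_eq k T i i"
proof -
  have path: "definable k T (\<lambda>a. a x = a y \<or> a y = a u \<or> a u = a v)"
    if s: "fst x = i" "fst y = i" "fst u = i" "fst v = i" for x y u v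
  proof -
    obtain w where w: "fst w = i" "w \<notin> {x, y, u, v}" using fresh_var[of "{x, y, u, v}"] by blast
    have "definable k T (\<lambda>a. (a x = a y \<or> a y = a w) \<and> (a w = a u \<or> a u = a v))"
      using s w by (intro definable_conj assms(1)) auto
    from definable_ex[OF this, of w] show ?thesis
    proof (rule definable_cong)
      fix a :: "svar \<Rightarrow> bit"
      show "(\<exists>c. ((a(w := c)) x = (a(w := c)) y \<or> (a(w := c)) y = (a(w := c)) w) \<and>
        ((a(w := c)) w = (a(w := c)) u \<or> (a(w := c)) u = (a(w := c)) v))
        = (a x = a y \<or> a y = a u \<or> a u = a v)"
        using w by auto
    qed (use w assms(2) in auto)
  qed
  show ?thesis unfolding eq_or_eq_def
  proof (intro allI impI)
    fix u u' v v' :: svar assume s: "fst u = i" "fst u' = i" "fst v = i" "fst v' = i"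
    \<comment> \<open>If both outer equations failed, the two middle ones would give
      \<open>a v = a u' = a v'\<close>, a contradiction.\<close>
    have "definable k T (\<lambda>a. (a u = a u' \<or> a u' = a v \<or> a v = a v') \<and> (a u = a u' \<or> a u' = a v' \<or> a v' = a v))"
      using s by (intro definable_conj path) auto
    then show "definable k T (\<lambda>a. a u = a u' \<or> a v = a v')"
    proof (rule definable_cong)
      fix a :: "svar \<Rightarrow> bit"
      show "((a u = a u' \<or> a u' = a v \<or> a v = a v') \<and> (a u = a u' \<or> a u' = a v' \<or> a v' = a v))
        = (a u = a u' \<or> a v = a v')"
        by (cases "a u"; cases "a u'"; cases "a v"; cases "a v'"; simp only: bit.distinct simp_thms)
    qed
  qed
qed

section \<open>Canonical forms\<close>

lemma canonical_form_vars:
  "canonical_form k V P \<Longrightarrow> finite V \<and> fst ` V \<subseteq> {1..k} \<and> depends_only V P"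
proof (induction rule: canonical_form.induct)
  case (c6 n s b)
  have "{(s t, 0) |t. t \<in> {1..n}} = (\<lambda>t. (s t, 0)) ` {1..n}" by auto
  then have "finite {(s t, 0 :: nat) |t. t \<in> {1..n}}" by simp
  moreover have "depends_only {(s t, 0) |t. t \<in> {1..n}} (\<lambda>a. (\<Sum>t = 1..n. a (s t, 0)) = b)"
    unfolding depends_only_def
  proof (intro allI impI)
    fix a a' :: "svar \<Rightarrow> bit" assume "\<forall>v\<in>{(s t, 0) |t. t \<in> {1..n}}. a v = a' v"
    then have "(\<Sum>t = 1..n. a (s t, 0)) = (\<Sum>t = 1..n. a' (s t, 0))"
      by (intro sum.cong) auto
    then show "((\<Sum>t = 1..n. a (s t, 0)) = b) = ((\<Sum>t = 1..n. a' (s t, 0)) = b)" by simp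
  qed
  ultimately show ?case using c6 by auto
next
  case (c7 n s m b)
  let ?V = "{(s t, p) |t p. t \<in> {1..n} \<and> p \<in> {1..m t}}"
  have "?V \<subseteq> (\<lambda>(t, p). (s t, p)) ` (SIGMA t:{1..n}. {1..m t})" by force
  then have "finite ?V" by (rule finite_subset) auto
  moreover have "depends_only ?V (\<lambda>a. \<exists>t\<in>{1..n}. \<exists>p\<in>{1..m t}. a (s t, p) = b t)"
    unfolding depends_only_def
  proof (intro allI impI)
    fix a a' :: "svar \<Rightarrow> bit" assume "\<forall>v\<in>?V. a v = a' v"
    then have "a (s t, p) = a' (s t, p)" if "t \<in> {1..n}" "p \<in> {1..m t}" for t p using that by blast
    then show "(\<exists>t\<in>{1..n}. \<exists>p\<in>{1..m t}. a (s t, p) = b t) = (\<exists>t\<in>{1..n}. \<exists>p\<in>{1..m t}. a' (s t, p) = b t)"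
      by auto
  qed
  moreover have "fst ` ?V \<subseteq> {1..k}" using c7(3) by fastforce
  ultimately show ?case by blast
qed (auto simp: depends_only_def)

text \<open>\<open>ess\<close> says that every variable of the form matters at some assignment. This
  rules out dummy positions, which membership in \<open>CR k\<close> requires.\<close>

lemma canonical_definable:
  assumes S: "S \<subseteq> srels k" and can: "canonical_form k V P" and P: "definable k S P"
    and ess: "\<And>v. v \<in> V \<Longrightarrow> \<exists>a. P (a(v := a v + 1)) \<noteq> P a"
  shows "definable k (qpp k S \<inter> CR k) P"
proof -
  have V: "finite V" "fst ` V \<subseteq> {1..k}" "depends_only V P" using canonical_form_vars[OF can] by auto
  obtain vs where vs: "set vs = V" "distinct vs" using finite_distinct_list V(1) by blast
  let ?R = "rel_on vs P"
  have mem: "map a vs \<in> tuples ?R \<longleftrightarrow> P a" for a by (rule map_in_rel_on) (use V vs in simp)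
  have so: "sorts ?R = map fst vs" by (simp add: rel_on_def)
  have "\<not> dummy ?R p" for p
  proof
    assume d: "dummy ?R p"
    then have p: "p < length vs" by (simp add: dummy_def so)
    with vs obtain a where a: "P (a(vs ! p := a (vs ! p) + 1)) \<noteq> P a" using ess nth_mem by metis
    have "map (a(vs ! p := c)) vs = (map a vs)[p := c]" for c
      by (rule nth_equalityI) (use p vs in \<open>auto simp: nth_list_update nth_eq_iff_index_eq\<close>)
    moreover have "(map a vs)[p := c] \<in> tuples ?R \<longleftrightarrow> map a vs \<in> tuples ?R" for c
      using d unfolding dummy_def so by simp
    ultimately show False using a mem by metis
  qed
  moreover have "?R \<in> srels k" by (rule rel_on_srels) (use V vs in simp)
  ultimately have "?R \<in> CR k" using can vs unfolding CR_def by blast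
  moreover have "?R \<in> qpp k S" by (rule qpp_rel_on[OF S P]) (use V vs in auto)
  ultimately have "definable k (qpp k S \<inter> CR k) (\<lambda>a. map a vs \<in> tuples ?R)"
    by (intro definable_Atom) (auto simp: so)
  then show ?thesis by (rule definable_cong) (simp add: mem)
qed

text \<open>The list of canonical forms prescribes variable names. A left inverse of
  \<open>\<rho>\<close> on \<open>V\<close> carries the given instance back to those names, where
  the form is recognised; renaming by \<open>\<rho>\<close> then returns to the instance.\<close>

lemma canonical_definable_rename:
  assumes S: "S \<subseteq> srels k" and can: "canonical_form k V P"
    and ess: "\<And>v. v \<in> V \<Longrightarrow> \<exists>a. P (a(v := a v + 1)) \<noteq> P a"
    and \<rho>: "\<And>v. fst (\<rho> v) = fst v" "inj_on \<rho> V"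
    and P: "definable k S (\<lambda>a. P (\<lambda>v. a (\<rho> v)))"
  shows "definable k (qpp k S \<inter> CR k) (\<lambda>a. P (\<lambda>v. a (\<rho> v)))"
proof -
  define \<sigma> where "\<sigma> w = (if w \<in> \<rho> ` V then the_inv_into V \<rho> w else w)" for w
  have inv: "\<sigma> (\<rho> v) = v" if "v \<in> V" for v
    using that \<rho>(2) by (simp add: \<sigma>_def the_inv_into_f_f)
  have "fst (\<sigma> w) = fst w" for w
  proof (cases "w \<in> \<rho> ` V")
    case True
    then obtain v where "w = \<rho> v" "v \<in> V" by blast
    then show ?thesis using inv \<rho>(1) by metis
  qed (simp add: \<sigma>_def)
  from definable_rename[OF P this] have "definable k S (\<lambda>a. P (\<lambda>v. a (\<sigma> (\<rho> v))))" .
  then have "definable k S P"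
  proof (rule definable_cong)
    fix a show "P (\<lambda>v. a (\<sigma> (\<rho> v))) = P a"
      by (rule depends_onlyD[of V]) (use canonical_form_vars[OF can] inv in auto)
  qed
  from definable_rename[OF canonical_definable[OF S can this ess] \<rho>(1)] show ?thesis .
qed

section \<open>Recognising canonical relations on arbitrary variables\<close>

abbreviation core :: "nat \<Rightarrow> srel set \<Rightarrow> srel set" where
  "core k S \<equiv> qpp k S \<inter> CR k"

lemma core_implication:
  assumes S: "S \<subseteq> srels k" and pq: "p \<noteq> q" "fst p = fst q" "fst p \<in> {1..k}"
    and P: "definable k S (\<lambda>a. a p = 0 \<or> a q = 1)"
  shows "definable k (core k S) (\<lambda>a. a p = 0 \<or> a q = 1)"
proof -
  let ?i = "fst p" let ?\<rho> = "id((?i, 0) := p, (?i, 1) := q)"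
  let ?P = "\<lambda>a :: svar \<Rightarrow> bit. a (?i, 0) = 0 \<or> a (?i, 1) = 1"
  have eq: "(\<lambda>a. ?P (\<lambda>v. a (?\<rho> v))) = (\<lambda>a. a p = 0 \<or> a q = 1)" by simp
  have "definable k (core k S) (\<lambda>a. ?P (\<lambda>v. a (?\<rho> v)))"
  proof (rule canonical_definable_rename[OF S canonical_form.c1[OF pq(3)]])
    show "\<exists>a. ?P (a(v := a v + 1)) \<noteq> ?P a" if "v \<in> {(?i, 0), (?i, 1)}" for v
      using that by (intro exI[of _ "\<lambda>w. if w = (?i, 0) then 1 else 0"]) auto
    show "fst (?\<rho> v) = fst v" for v using pq by simp
    show "inj_on ?\<rho> {(?i, 0), (?i, 1)}" unfolding inj_on_def using pq by simp
    show "definable k S (\<lambda>a. ?P (\<lambda>v. a (?\<rho> v)))" unfolding eq by (rule P)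
  qed
  then show ?thesis unfolding eq .
qed

lemma core_disequality:
  assumes S: "S \<subseteq> srels k" and pq: "p \<noteq> q" "fst p = fst q" "fst p \<in> {1..k}"
    and P: "definable k S (\<lambda>a. a p + a q = 1)"
  shows "definable k (core k S) (\<lambda>a. a p + a q = 1)"
proof -
  let ?i = "fst p" let ?\<rho> = "id((?i, 0) := p, (?i, 1) := q)"
  let ?P = "\<lambda>a :: svar \<Rightarrow> bit. a (?i, 0) + a (?i, 1) = 1"
  have eq: "(\<lambda>a. ?P (\<lambda>v. a (?\<rho> v))) = (\<lambda>a. a p + a q = 1)" by simp
  have "definable k (core k S) (\<lambda>a. ?P (\<lambda>v. a (?\<rho> v)))"
  proof (rule canonical_definable_rename[OF S canonical_form.c4[OF pq(3)]])
    show "\<exists>a. ?P (a(v := a v + 1)) \<noteq> ?P a" if "v \<in> {(?i, 0), (?i, 1)}" for v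
      using that by (intro exI[of _ "\<lambda>w. 0"]) auto
    show "fst (?\<rho> v) = fst v" for v using pq by simp
    show "inj_on ?\<rho> {(?i, 0), (?i, 1)}" unfolding inj_on_def using pq by simp
    show "definable k S (\<lambda>a. ?P (\<lambda>v. a (?\<rho> v)))" unfolding eq by (rule P)
  qed
  then show ?thesis unfolding eq .
qed

lemma core_parallelogram:
  assumes S: "S \<subseteq> srels k" and pq: "distinct [p, q, u, v]" "fst p = fst q" "fst u = fst v"
      "fst p \<in> {1..k}" "fst u \<in> {1..k}"
    and P: "definable k S (\<lambda>a. a p + a q = a u + a v)"
  shows "definable k (core k S) (\<lambda>a. a p + a q = a u + a v)"
proof -
  let ?i = "fst p" let ?j = "fst u"
  let ?\<rho> = "id((?i, 0) := p, (?i, 1) := q, (?j, 2) := u, (?j, 3) := v)"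
  let ?P = "\<lambda>a :: svar \<Rightarrow> bit. a (?i, 0) + a (?i, 1) = a (?j, 2) + a (?j, 3)"
  have eq: "(\<lambda>a. ?P (\<lambda>v. a (?\<rho> v))) = (\<lambda>a. a p + a q = a u + a v)" by simp
  have "definable k (core k S) (\<lambda>a. ?P (\<lambda>v. a (?\<rho> v)))"
  proof (rule canonical_definable_rename[OF S canonical_form.c5[OF pq(4,5)]])
    show "\<exists>a. ?P (a(w := a w + 1)) \<noteq> ?P a" if "w \<in> {(?i, 0), (?i, 1), (?j, 2), (?j, 3)}" for w
      using that by (intro exI[of _ "\<lambda>w. 0"]) auto
    show "fst (?\<rho> v) = fst v" for v using pq by simp
    have "distinct (map ?\<rho> [(?i, 0), (?i, 1), (?j, 2), (?j, 3)])" using pq(1) by simp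
    then show "inj_on ?\<rho> {(?i, 0), (?i, 1), (?j, 2), (?j, 3)}" unfolding distinct_map by simp
    show "definable k S (\<lambda>a. ?P (\<lambda>v. a (?\<rho> v)))" unfolding eq by (rule P)
  qed
  then show ?thesis unfolding eq .
qed

lemma core_eq_or_literal:
  assumes S: "S \<subseteq> srels k" and i: "i \<in> {1..k}" "fst w \<in> {1..k}"
    and E: "eq_or k S i (\<lambda>a. a w = b)"
  shows "eq_or k (core k S) i (\<lambda>a. a w = b)"
proof -
  obtain p where p: "fst p = i" "p \<notin> {w}" using fresh_var[of "{w}"] by blast
  obtain q where q: "fst q = i" "q \<notin> {w, p}" using fresh_var[of "{w, p}"] by blast
  let ?j = "fst w" let ?\<rho> = "id((i, 0) := p, (i, 1) := q, (?j, 2) := w)"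
  let ?P = "\<lambda>a :: svar \<Rightarrow> bit. a (i, 0) = a (i, 1) \<or> a (?j, 2) = b"
  have eq: "(\<lambda>a. ?P (\<lambda>v. a (?\<rho> v))) = (\<lambda>a. a p = a q \<or> a w = b)" by simp
  have "definable k (core k S) (\<lambda>a. ?P (\<lambda>v. a (?\<rho> v)))"
  proof (rule canonical_definable_rename[OF S canonical_form.c2[OF i]])
    \<comment> \<open>The last variable matters where the first two differ, and the first two matter
      where the last one differs from \<open>b\<close>.\<close>
    show "\<exists>a. ?P (a(v := a v + 1)) \<noteq> ?P a" if "v \<in> {(i, 0), (i, 1), (?j, 2)}" for v
    proof (cases "v = (?j, 2)")
      case True
      then show ?thesis by (intro exI[of _ "\<lambda>w. if w = (i, 0) then 1 else if w = (?j, 2) then b else 0"]) auto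
    next
      case False
      then show ?thesis using that by (intro exI[of _ "\<lambda>w. if w = (?j, 2) then b + 1 else 0"]) (cases b; auto)
    qed
    show "definable k S (\<lambda>a. ?P (\<lambda>v. a (?\<rho> v)))" unfolding eq by (rule eq_orD[OF E p(1) q(1)])
  qed (use p q in \<open>auto simp: inj_on_def\<close>)
  then show ?thesis unfolding eq
    by (rule eq_orI[where F = "{w}"]) (use p q in \<open>auto simp: depends_only_def\<close>)
qed

text \<open>For two different sorts the relation itself is canonical. Within one sort only the form
  with a shared middle variable is listed, so two variables are identified and
  \<open>eq_or_eq_of_path\<close> recovers the relation with four variables.\<close>

lemma core_eq_or_eq:
  assumes S: "S \<subseteq> srels k" and ij: "i \<in> {1..k}" "j \<in> {1..k}" and E: "eq_or_eq k S i j"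
  shows "eq_or_eq k (core k S) i j"
proof (cases "i = j")
  case False
  let ?P = "\<lambda>a :: svar \<Rightarrow> bit. a (i, 0) = a (i, 1) \<or> a (j, 2) = a (j, 3)"
  have "definable k (core k S) ?P"
  proof (rule canonical_definable[OF S canonical_form.c3_diff[OF ij False]])
    show "\<exists>a. ?P (a(v := a v + 1)) \<noteq> ?P a" if "v \<in> {(i, 0), (i, 1), (j, 2), (j, 3)}" for v
    proof (cases "v \<in> {(i, 0), (i, 1)}")
      case True
      then show ?thesis by (intro exI[of _ "\<lambda>w. if w = (j, 2) then 1 else 0"]) auto
    next
      case F: False
      then show ?thesis using that by (intro exI[of _ "\<lambda>w. if w = (i, 0) then 1 else 0"]) auto
    qed
    show "definable k S ?P" by (rule eq_or_eqD[OF E]) auto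
  qed
  then show ?thesis by (rule eq_or_eqI) auto
next
  case True
  let ?P = "\<lambda>a :: svar \<Rightarrow> bit. a (i, 0) = a (i, 1) \<or> a (i, 1) = a (i, 2)"
  have *: "definable k (core k S) ?P"
  proof (rule canonical_definable[OF S canonical_form.c3_same[OF ij(1)]])
    show "\<exists>a. ?P (a(v := a v + 1)) \<noteq> ?P a" if "v \<in> {(i, 0), (i, 1), (i, 2)}" for v
    proof (cases "v = (i, 0)")
      case True
      then show ?thesis by (intro exI[of _ "\<lambda>w. if w = (i, 2) then 1 else 0"]) auto
    next
      case F: False
      then show ?thesis using that
        by (cases "v = (i, 1)"; intro exI[of _ "\<lambda>w. if v = (i, 1) then 0 else if w = (i, 0) then 1 else 0"]) auto
    qed
    show "definable k S ?P" by (rule eq_or_eqD[OF E]) (use True in auto)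
  qed
  show ?thesis unfolding True[symmetric]
  proof (rule eq_or_eq_of_path)
    fix x y z :: svar assume s: "fst x = i" "fst y = i" "fst z = i"
    let ?\<rho> = "id((i, 0) := x, (i, 1) := y, (i, 2) := z)"
    have "definable k (core k S) (\<lambda>a. ?P (\<lambda>v. a (?\<rho> v)))"
      by (rule definable_rename[where \<rho> = ?\<rho>, OF *]) (use s in auto)
    then show "definable k (core k S) (\<lambda>a. a x = a y \<or> a y = a z)"
      by (rule definable_cong) auto
  qed (use ij in auto)
qed

lemma core_lin_distinct_sorts:
  assumes S: "S \<subseteq> srels k" and X: "finite X" "card X \<ge> 2" "inj_on fst X" "fst ` X \<subseteq> {1..k}"
    and P: "definable k S (\<lambda>a. sum a X = b)"
  shows "definable k (core k S) (\<lambda>a. sum a X = b)"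
proof -
  obtain g where g: "bij_betw g {1..card X} X" using ex_bij_betw_nat_finite_1[OF X(1)] by blast
  define n where "n = card X"
  define s where "s = fst \<circ> g"
  let ?V = "{(s t, 0) |t. t \<in> {1..n}}"
  let ?P = "\<lambda>a :: svar \<Rightarrow> bit. (\<Sum>t = 1..n. a (s t, 0)) = b"
  have s: "inj_on s {1..n}" "s ` {1..n} = fst ` X"
    using g X(3) unfolding s_def n_def bij_betw_def by (metis comp_inj_on, metis image_comp)
  \<comment> \<open>No two variables of \<open>X\<close> share a sort, so the canonical variable of
    a sort is sent to the unique variable of \<open>X\<close> of that sort.\<close>
  define \<rho> where "\<rho> v = (if snd v = 0 \<and> fst v \<in> fst ` X then the_inv_into X fst (fst v) else v)" for v :: svar
  have inv: "the_inv_into X fst (fst x) = x" if "x \<in> X" for x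
    using that X(3) by (simp add: the_inv_into_f_f)
  have gX: "g t \<in> X" if "t \<in> {1..n}" for t using g that unfolding n_def bij_betw_def by blast
  have \<rho>g: "\<rho> (s t, 0) = g t" if "t \<in> {1..n}" for t
    using gX[OF that] inv unfolding \<rho>_def s_def by auto
  have "(\<Sum>t = 1..n. a (\<rho> (s t, 0))) = sum a X" for a :: "svar \<Rightarrow> bit"
  proof -
    have "(\<Sum>t = 1..n. a (\<rho> (s t, 0))) = (\<Sum>t = 1..n. a (g t))" by (rule sum.cong) (use \<rho>g in auto)
    also have "\<dots> = sum a X" using sum.reindex_bij_betw[OF g, of a] unfolding n_def .
    finally show ?thesis .
  qed
  then have eq: "(\<lambda>a. ?P (\<lambda>v. a (\<rho> v))) = (\<lambda>a. sum a X = b)" by simp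
  have "definable k (core k S) (\<lambda>a. ?P (\<lambda>v. a (\<rho> v)))"
  proof (rule canonical_definable_rename[OF S canonical_form.c6])
    show "n \<ge> 2" "inj_on s {1..n}" "s ` {1..n} \<subseteq> {1..k}" using X s n_def by auto
    show "\<exists>a. ?P (a(v := a v + 1)) \<noteq> ?P a" if "v \<in> ?V" for v
    proof -
      have V: "?V = (\<lambda>t. (s t, 0)) ` {1..n}" by auto
      have "inj_on (\<lambda>t. (s t, 0 :: nat)) {1..n}" using s(1) unfolding inj_on_def by blast
      then have r: "(\<Sum>t = 1..n. a (s t, 0)) = sum a ?V" for a :: "svar \<Rightarrow> bit"
        unfolding V by (simp add: sum.reindex)
      define z where "z w = (0 :: bit)" for w :: svar
      have z0: "sum z ?V = 0" by (simp add: z_def)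
      have "finite ?V" unfolding V by simp
      from sum_upd[OF this that, of z "z v + 1"] have z1: "sum (z(v := z v + 1)) ?V = 1"
        unfolding z0 by (simp add: z_def)
      have "(sum (z(v := z v + 1)) ?V = b) \<noteq> (sum z ?V = b)"
        unfolding z0 z1 by (cases b) simp_all
      then show ?thesis unfolding r by blast
    qed
    show "fst (\<rho> v) = fst v" for v
      using inv by (auto simp: \<rho>_def)
    show "inj_on \<rho> ?V"
    proof (rule inj_onI)
      fix v w assume "v \<in> ?V" "w \<in> ?V" "\<rho> v = \<rho> w"
      then obtain t t' where t: "v = (s t, 0)" "w = (s t', 0)" "t \<in> {1..n}" "t' \<in> {1..n}" "g t = g t'"
        using \<rho>g by force
      then have "t = t'" using g unfolding n_def bij_betw_def inj_on_def by blast
      with t show "v = w" by simp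
    qed
    show "definable k S (\<lambda>a. ?P (\<lambda>v. a (\<rho> v)))" unfolding eq by (rule P)
  qed
  then show ?thesis unfolding eq .
qed

text \<open>In \<open>c7\<close> the constant depends on the sort alone, which is what
  \<open>sgn\<close> guarantees. The remaining work is to number the variables of each sort from
  1.\<close>

lemma core_clause_unmixed:
  assumes S: "S \<subseteq> srels k" and W: "finite W" "W \<noteq> {}" "fst ` W \<subseteq> {1..k}"
    and sgn: "\<And>v w. v \<in> W \<Longrightarrow> w \<in> W \<Longrightarrow> fst v = fst w \<Longrightarrow> t v = t w"
    and P: "definable k S (\<lambda>a. \<exists>w\<in>W. a w = t w)"
  shows "definable k (core k S) (\<lambda>a. \<exists>w\<in>W. a w = t w)"
proof -
  define Ws where "Ws i = {v \<in> W. fst v = i}" for i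
  have fWs: "finite (Ws i)" for i using W(1) unfolding Ws_def by simp
  have "\<exists>h. bij_betw h {1..card (Ws i)} (Ws i)" for i using ex_bij_betw_nat_finite_1[OF fWs] by blast
  then obtain h where h: "\<And>i. bij_betw (h i) {1..card (Ws i)} (Ws i)" by metis
  define n where "n = card (fst ` W)"
  obtain s where s: "bij_betw s {1..n} (fst ` W)"
    using ex_bij_betw_nat_finite_1[of "fst ` W"] W(1) unfolding n_def by blast
  define m where "m r = card (Ws (s r))" for r
  \<comment> \<open>By \<open>sgn\<close> all variables of this sort carry the same constant, so any
    representative will do.\<close>
  define b where "b r = t (SOME v. v \<in> Ws (s r))" for r
  let ?V = "{(s r, p) |r p. r \<in> {1..n} \<and> p \<in> {1..m r}}"
  let ?P = "\<lambda>a :: svar \<Rightarrow> bit. \<exists>r\<in>{1..n}. \<exists>p\<in>{1..m r}. a (s r, p) = b r"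
  have simg: "s ` {1..n} = fst ` W" and sinj: "inj_on s {1..n}" using s by (auto simp: bij_betw_def)
  have ne: "Ws (s r) \<noteq> {}" if "r \<in> {1..n}" for r
    using that simg unfolding Ws_def by fastforce
  have b: "t v = b r" if "r \<in> {1..n}" "v \<in> Ws (s r)" for r v
  proof -
    have "(SOME v. v \<in> Ws (s r)) \<in> Ws (s r)" using ne[OF that(1)] by (simp add: some_in_eq)
    then show ?thesis unfolding b_def using that by (intro sgn) (auto simp: Ws_def)
  qed
  define \<rho> where "\<rho> v = (if snd v \<in> {1..card (Ws (fst v))} then h (fst v) (snd v) else v)" for v :: svar
  have hW: "h i p \<in> Ws i" if "p \<in> {1..card (Ws i)}" for i p using h[of i] that by (auto simp: bij_betw_def)
  have \<rho>h: "\<rho> (s r, p) = h (s r) p" if "p \<in> {1..m r}" for r p using that unfolding \<rho>_def m_def by simp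
  have hi: "h i ` {1..card (Ws i)} = Ws i" for i using h[of i] by (simp add: bij_betw_def)
  have "?P (\<lambda>v. a (\<rho> v)) = (\<exists>w\<in>W. a w = t w)" for a :: "svar \<Rightarrow> bit"
  proof
    assume "?P (\<lambda>v. a (\<rho> v))"
    then obtain r p where rp: "r \<in> {1..n}" "p \<in> {1..m r}" "a (\<rho> (s r, p)) = b r" by blast
    then have "h (s r) p \<in> Ws (s r)" using hW unfolding m_def by simp
    then show "\<exists>w\<in>W. a w = t w" 
      using b[OF rp(1) \<open>h (s r) p \<in> Ws (s r)\<close>] \<rho>h[OF rp(2)] rp(3)
      by (intro bexI[of _ "h (s r) p"]) (auto simp: Ws_def)
  next
    assume "\<exists>w\<in>W. a w = t w"
    then obtain w where w: "w \<in> W" "a w = t w" by blast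
    then obtain r where r: "r \<in> {1..n}" "s r = fst w" using simg by (metis image_eqI imageE)
    have "w \<in> Ws (s r)" using w r by (simp add: Ws_def)
    then obtain p where "p \<in> {1..m r}" "w = h (s r) p" using hi[of "s r"] unfolding m_def by blast
    then have "a (\<rho> (s r, p)) = b r" using w b[OF r(1) \<open>w \<in> Ws (s r)\<close>] \<rho>h by simp
    with \<open>p \<in> {1..m r}\<close> r show "?P (\<lambda>v. a (\<rho> v))" by blast
  qed
  then have eq: "(\<lambda>a. ?P (\<lambda>v. a (\<rho> v))) = (\<lambda>a. \<exists>w\<in>W. a w = t w)" by (rule ext)
  have "definable k (core k S) (\<lambda>a. ?P (\<lambda>v. a (\<rho> v)))"
  proof (rule canonical_definable_rename[OF S canonical_form.c7])
    have "n \<noteq> 0" using W unfolding n_def by simp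
    then show "n \<ge> 1" by simp
    show "inj_on s {1..n}" by (rule sinj)
    show "s ` {1..n} \<subseteq> {1..k}" using simg W by simp
    have "m r \<noteq> 0" if "r \<in> {1..n}" for r using ne[OF that] fWs unfolding m_def by simp
    then show "m r \<ge> 1" if "r \<in> {1..n}" for r using that by (metis One_nat_def Suc_leI neq0_conv)
    show "\<exists>a. ?P (a(v := a v + 1)) \<noteq> ?P a" if vV: "v \<in> ?V" for v
    proof -
      obtain r p where rp: "v = (s r, p)" "r \<in> {1..n}" "p \<in> {1..m r}" using vV by blast
      \<comment> \<open>This assignment falsifies every literal, so flipping any single variable of
        the clause makes the clause true.\<close>
      define a where "a w = b (the_inv_into {1..n} s (fst w)) + 1" for w :: svar
      have a: "a (s r', p') = b r' + 1" if "r' \<in> {1..n}" for r' p'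
        using that sinj by (simp add: a_def the_inv_into_f_f)
      have ne: "b r' + 1 \<noteq> b r'" for r' by (cases "b r'") auto
      then have "\<not> ?P a" using a by metis
      moreover have "b r + 1 + 1 = b r" by (cases "b r") auto
      then have "(a(v := a v + 1)) (s r, p) = b r" using a rp by simp
      then have "?P (a(v := a v + 1))" using rp by blast
      ultimately show ?thesis by blast
    qed
    show f: "fst (\<rho> v) = fst v" for v
      using hW unfolding \<rho>_def Ws_def by auto
    show "inj_on \<rho> ?V"
    proof (rule inj_onI)
      fix v w assume vw: "v \<in> ?V" "w \<in> ?V" "\<rho> v = \<rho> w"
      then obtain r p r' p' where r: "v = (s r, p)" "w = (s r', p')" "p \<in> {1..m r}" "p' \<in> {1..m r'}" by blast
      have e: "s r = s r'" using f[of v] f[of w] vw(3) r by simp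
      have "h (s r) p = h (s r') p'" using vw(3) unfolding r(1,2) \<rho>h[OF r(3)] \<rho>h[OF r(4)] .
      then have "h (s r) p = h (s r) p'" by (simp only: e)
      then have "p = p'" using h[of "s r"] r e unfolding bij_betw_def inj_on_def m_def by metis
      with e r show "v = w" by simp
    qed
    show "definable k S (\<lambda>a. ?P (\<lambda>v. a (\<rho> v)))" unfolding eq by (rule P)
  qed
  then show ?thesis unfolding eq .
qed

section \<open>Linear equations and clauses\<close>

text \<open>With pairwise different sorts the equation is \<open>c6\<close>, or a one-literal
  \<open>c7\<close>. Otherwise two variables \<open>p\<close>, \<open>q\<close> of equal sort are
  split off: the rest \<open>Y\<close> is handled by induction, and a parallelogram
  \<open>c5\<close> reattaches the pair. If \<open>Y\<close> is empty, the equation is an equality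
  or \<open>c4\<close>.\<close>

lemma core_lin:
  assumes S: "S \<subseteq> srels k"
  shows "finite X \<Longrightarrow> X \<noteq> {} \<Longrightarrow> fst ` X \<subseteq> {1..k} \<Longrightarrow> definable k S (\<lambda>a. sum a X = b) \<Longrightarrow>
    definable k (core k S) (\<lambda>a. sum a X = b)"
proof (induction "card X" arbitrary: X rule: less_induct)
  case less
  note X = less.prems
  show ?case
  proof (cases "inj_on fst X")
    case True
    show ?thesis
    proof (cases "card X \<ge> 2")
      case False
      then have "card X = 1" using X(1,2) card_gt_0_iff[of X] by linarith
      then obtain x where x: "X = {x}" by (auto simp: card_1_singleton_iff)
      have eq: "(\<lambda>a. sum a X = b) = (\<lambda>a. \<exists>w\<in>{x}. a w = b)" unfolding x by (simp del: add_bit_eq_xor)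
      show ?thesis unfolding eq
        by (rule core_clause_unmixed[OF S]) (use X x eq in auto)
    qed (rule core_lin_distinct_sorts[OF S X(1) _ True X(3,4)])
  next
    case False
    then obtain p q where pq: "p \<in> X" "q \<in> X" "p \<noteq> q" "fst p = fst q" unfolding inj_on_def by blast
    define Y where "Y = X - {p, q}"
    have Y: "finite Y" "p \<notin> Y" "q \<notin> Y" "Y \<subseteq> X" "fst ` Y \<subseteq> {1..k}" using X unfolding Y_def by auto
    have "X = insert p (insert q Y)" using pq unfolding Y_def by auto
    then have sX: "sum a X = a p + (a q + sum a Y)" for a :: "svar \<Rightarrow> bit"
      using Y pq by (simp del: add_bit_eq_xor)
    have pk: "fst p \<in> {1..k}" using X pq by auto
    show ?thesis
    proof (cases "Y = {}")
      case True
      then have sX': "sum a X = a p + a q" for a :: "svar \<Rightarrow> bit" using sX[of a] by simp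
      show ?thesis
      proof (cases "b = 0")
        case b: True
        have "(a p = a q) = (a p + a q = 0)" for a :: "svar \<Rightarrow> bit"
          by (cases "a p"; cases "a q"; simp)
        with definable_eq[OF pq(4) pk, of "core k S"] show ?thesis
          unfolding sX' b by simp
      next
        case False
        then have b: "b = 1" by (cases b) auto
        show ?thesis unfolding sX' b
          by (rule core_disequality[OF S pq(3,4) pk]) (use X(4) in \<open>simp only: sX' b\<close>)
      qed
    next
      case False
      then obtain r where r: "r \<in> Y" by blast
      then have rk: "fst r \<in> {1..k}" and rpq: "r \<noteq> p" "r \<noteq> q" using Y by auto
      \<comment> \<open>Identifying \<open>p\<close> with \<open>q\<close> cancels the pair modulo 2
        and leaves the equation over \<open>Y\<close>.\<close>
      have "definable k S (\<lambda>a. sum (a(p := a q)) X = b)"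
        by (rule definable_subst[OF X(4)]) (use pq in simp)
      then have "definable k S (\<lambda>a. sum a Y = b)"
      proof (rule definable_cong)
        fix a :: "svar \<Rightarrow> bit"
        have "sum (a(p := a q)) X = a q + (a q + sum a Y)"
          unfolding sX using sum_upd_notin[OF Y(2), of a "a q"] pq by simp
        also have "\<dots> = sum a Y" by (cases "a q"; cases "sum a Y"; simp)
        finally show "(sum (a(p := a q)) X = b) = (sum a Y = b)" by simp
      qed
      moreover have "card Y < card X" unfolding Y_def using pq X(1) by (intro psubset_card_mono) auto
      ultimately have cY: "definable k (core k S) (\<lambda>a. sum a Y = b)"
        using less.hyps[of Y] Y False by blast
      obtain p' where p': "fst p' = fst p" "p' \<notin> X" using fresh_var X(1) by blast
      obtain r' where r': "fst r' = fst r" "r' \<notin> insert p' X" using fresh_var[of "insert p' X"] X(1) by blast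
      have ne: "p' \<noteq> p" "p' \<noteq> q" "p' \<noteq> r" "r' \<noteq> p" "r' \<noteq> q" "r' \<noteq> r" "r' \<noteq> p'" "r' \<notin> Y" "p' \<notin> Y"
        using p' r' pq r Y by auto
      let ?L = "\<lambda>a :: svar \<Rightarrow> bit. sum a X = b"
      \<comment> \<open>Adding the equation to its copy with \<open>p'\<close>, \<open>r'\<close>
        for \<open>p\<close>, \<open>r\<close> cancels everything else. Since \<open>q\<close> can
        always be chosen to satisfy the first copy, quantifying it leaves exactly the
        parallelogram.\<close>
      have "definable k S (\<lambda>a. ?L a \<and> ?L (a(p := a p', r := a r')))"
        by (intro definable_conj definable_subst2 X(4)) (use p' r' in auto)
      from definable_ex[OF this, of q] have
        "definable k S (\<lambda>a. \<exists>c. ?L (a(q := c)) \<and> ?L ((a(q := c))(p := (a(q := c)) p', r := (a(q := c)) r')))"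
        using pq pk by simp
      then have "definable k S (\<lambda>a. a p + a p' = a r + a r')"
      proof (rule definable_cong)
        fix a :: "svar \<Rightarrow> bit"
        have s1: "sum (a(q := c)) X = a p + (c + sum a Y)" for c
          unfolding sX using sum_upd_notin[OF Y(3), of a c] pq by simp
        have "sum (a(q := c, p := a p', r := a r')) Y = sum a Y + a r + a r'" for c
          using sum_upd[OF Y(1) r, of "a(q := c, p := a p')" "a r'"]
            sum_upd_notin[OF Y(2), of "a(q := c)" "a p'"] sum_upd_notin[OF Y(3), of a c] rpq by simp
        then have s2: "sum ((a(q := c))(p := (a(q := c)) p', r := (a(q := c)) r')) X = a p' + (c + (sum a Y + a r + a r'))" for c
          unfolding sX using ne pq rpq by simp
        have "(\<exists>c. x + (c + s) = b \<and> x' + (c + (s + y + y')) = b) = (x + x' = y + y')" for x x' y y' s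
        proof
          assume "\<exists>c. x + (c + s) = b \<and> x' + (c + (s + y + y')) = b"
          then obtain c where "x + (c + s) = b \<and> x' + (c + (s + y + y')) = b" by blast
          then show "x + x' = y + y'"
            by (cases x; cases x'; cases y; cases y'; cases s; cases c) auto
        next
          assume "x + x' = y + y'"
          then show "\<exists>c. x + (c + s) = b \<and> x' + (c + (s + y + y')) = b"
            by (intro exI[of _ "b + x + s"]) (cases x; cases x'; cases y; cases y'; cases s; cases b; simp)
        qed
        then show "(\<exists>c. ?L (a(q := c)) \<and> ?L ((a(q := c))(p := (a(q := c)) p', r := (a(q := c)) r')))
          = (a p + a p' = a r + a r')"
          unfolding s1 s2 .
      qed
      then have "definable k (core k S) (\<lambda>a. a p + a p' = a r + a r')"
        by (intro core_parallelogram[OF S]) (use ne rpq p' r' pk rk in auto)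
      from definable_subst[OF this, of q p'] have "definable k (core k S) (\<lambda>a. a p + a q = a r + a r')"
        using ne pq p' by simp
      \<comment> \<open>Replacing \<open>r\<close> by \<open>r'\<close> adds
        \<open>a r + a r'\<close> to the sum over \<open>Y\<close>, and the parallelogram turns this
        into \<open>a p + a q\<close>. The quantified \<open>r'\<close> is determined by the other
        variables.\<close>
      then have "definable k (core k S) (\<lambda>a. a p + a q = a r + a r' \<and> sum (a(r := a r')) Y = b)"
        by (rule definable_conj[OF _ definable_subst[OF cY r'(1)]])
      from definable_ex[OF this, of r'] have "definable k (core k S) (\<lambda>a. \<exists>c. (a(r' := c)) p + (a(r' := c)) q = (a(r' := c)) r + (a(r' := c)) r'
         \<and> sum ((a(r' := c))(r := (a(r' := c)) r')) Y = b)" using r' rk by simp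
      then show ?thesis
      proof (rule definable_cong)
        fix a :: "svar \<Rightarrow> bit"
        have s1: "sum ((a(r' := c))(r := (a(r' := c)) r')) Y = sum a Y + a r + c" for c
          using sum_upd[OF Y(1) r, of "a(r' := c)" c] sum_upd_notin[OF ne(8), of a c] ne by simp
        have s2: "(a(r' := c)) p + (a(r' := c)) q = (a(r' := c)) r + (a(r' := c)) r' \<longleftrightarrow> a p + a q = a r + c" for c
          using ne by simp
        have "(\<exists>c. x + y = z + c \<and> s + z + c = b) = (x + (y + s) = b)" for x y z s
        proof
          assume "\<exists>c. x + y = z + c \<and> s + z + c = b"
          then obtain c where "x + y = z + c \<and> s + z + c = b" by blast
          then show "x + (y + s) = b"
            by (cases x; cases y; cases z; cases s; cases c) auto
        next
          assume "x + (y + s) = b"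
          then show "\<exists>c. x + y = z + c \<and> s + z + c = b"
            by (intro exI[of _ "x + y + z"]) (cases x; cases y; cases z; cases s; simp)
        qed
        then show "(\<exists>c. (a(r' := c)) p + (a(r' := c)) q = (a(r' := c)) r + (a(r' := c)) r'
         \<and> sum ((a(r' := c))(r := (a(r' := c)) r')) Y = b) = (sum a X = b)"
          unfolding s1 s2 sX .
      qed
    qed
  qed
qed

text \<open>For one variable the link is \<open>c2\<close>. With at least two variables it reduces
  to a link between sorts, which \<open>c3\<close> covers, and is rebuilt from that link and the
  equation.\<close>

lemma core_eq_or_lin:
  assumes S: "S \<subseteq> srels k" and Q: "finite Q" "Q \<noteq> {}" "fst ` Q \<subseteq> {1..k}" and i: "i \<in> {1..k}"
    and E: "eq_or k S i (\<lambda>a. sum a Q = b)" and L: "definable k S (\<lambda>a. sum a Q = b)"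
  shows "eq_or k (core k S) i (\<lambda>a. sum a Q = b)"
proof -
  obtain q where q: "q \<in> Q" using Q by blast
  show ?thesis
  proof (cases "Q = {q}")
    case True
    have eq: "(\<lambda>a. sum a Q = b) = (\<lambda>a. a q = b)" unfolding True by (simp del: add_bit_eq_xor)
    show ?thesis using core_eq_or_literal[OF S i, of q b] E Q(3) True unfolding eq by simp
  next
    case False
    then obtain r where r: "r \<in> Q" "q \<noteq> r" using q by blast
    have "eq_or_eq k S i (fst q)" by (rule eq_or_lin_imp_eq_or_eq[OF E Q(1,3) q r])
    then have "eq_or_eq k (core k S) i (fst q)" using Q q i by (intro core_eq_or_eq[OF S]) auto
    then show ?thesis
      by (rule eq_or_eq_imp_eq_or_lin[OF _ core_lin[OF S Q L] Q(1,3) q])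
  qed
qed

text \<open>Universal quantification deletes a literal, because its variable may take the falsifying
  value \<open>t w\<close>.\<close>

lemma clause_subset:
  assumes P: "definable k T (\<lambda>a. \<exists>w\<in>W. a w \<noteq> t w)" and W: "finite W" "fst ` W \<subseteq> {1..k}" "U \<subseteq> W"
  shows "definable k T (\<lambda>a. \<exists>w\<in>U. a w \<noteq> t w)"
proof -
  have "definable k T (\<lambda>a. \<forall>b. (\<forall>v. v \<notin> W - U \<longrightarrow> b v = a v) \<longrightarrow> (\<exists>w\<in>W. b w \<noteq> t w))"
    by (rule definable_alls[OF _ _ P]) (use W in auto)
  then show ?thesis
  proof (rule definable_cong, intro iffI allI impI)
    fix a :: "svar \<Rightarrow> bit" assume *: "\<forall>b. (\<forall>v. v \<notin> W - U \<longrightarrow> b v = a v) \<longrightarrow> (\<exists>w\<in>W. b w \<noteq> t w)"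
    have "\<exists>w\<in>W. (if w \<in> W - U then t w else a w) \<noteq> t w"
      by (rule *[rule_format]) auto
    then show "\<exists>w\<in>U. a w \<noteq> t w" by (auto split: if_splits)
  next
    fix a b :: "svar \<Rightarrow> bit" assume "\<exists>w\<in>U. a w \<noteq> t w" "\<forall>v. v \<notin> W - U \<longrightarrow> b v = a v"
    then show "\<exists>w\<in>W. b w \<noteq> t w" using W(3) by (metis DiffD2 subsetD)
  qed
qed

text \<open>If some sort occurs with both signs, in literals \<open>p = 0\<close> and
  \<open>q = 1\<close>, the subclause on \<open>p\<close>, \<open>q\<close> is \<open>c1\<close>.
  Each remaining literal has a link at \<open>p\<close> of the form \<open>c2\<close>, and
  \<open>definable_disjs\<close> attaches it to that subclause.\<close>

lemma core_clause:
  assumes S: "S \<subseteq> srels k" and W: "finite W" "fst ` W \<subseteq> {1..k}"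
    and P: "definable k S (\<lambda>a. \<exists>w\<in>W. a w \<noteq> t w)"
  shows "definable k (core k S) (\<lambda>a. \<exists>w\<in>W. a w \<noteq> t w)"
proof (cases "W = {}")
  case True
  then show ?thesis using definable_False by simp
next
  case ne: False
  show ?thesis
  proof (cases "\<forall>v\<in>W. \<forall>w\<in>W. fst v = fst w \<longrightarrow> t v = t w")
    case True
    have "definable k (core k S) (\<lambda>a. \<exists>w\<in>W. a w = t w + 1)"
    proof (rule core_clause_unmixed[OF S W(1) ne W(2)])
      show "t v + 1 = t w + 1" if "v \<in> W" "w \<in> W" "fst v = fst w" for v w
        using True that by metis
      show "definable k S (\<lambda>a. \<exists>w\<in>W. a w = t w + 1)" using P unfolding bit_neq_iff .
    qed
    then show ?thesis unfolding bit_neq_iff .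
  next
    case False
    then obtain v w where vw: "v \<in> W" "w \<in> W" "fst v = fst w" "t v \<noteq> t w" by blast
    obtain p q where pq: "p \<in> W" "q \<in> W" "fst p = fst q" "t p = 1" "t q = 0"
    proof (cases "t v = 0")
      case True
      with vw have "t w = 1" by (cases "t w") auto
      with vw True that[of w v] show thesis by simp
    next
      case False
      with vw have "t w = 0" by (cases "t v"; cases "t w") auto
      with vw False that[of v w] show thesis by simp
    qed
    have pq': "p \<noteq> q" and pk: "fst p \<in> {1..k}" using pq W by auto
    have lit: "(x \<noteq> t p) = (x = 0)" "(x \<noteq> t q) = (x = 1)" for x using pq by auto
    have "definable k S (\<lambda>a. \<exists>w\<in>{p, q}. a w \<noteq> t w)"
      by (rule clause_subset[OF P W]) (use pq in auto)
    then have "definable k S (\<lambda>a. a p = 0 \<or> a q = 1)" by (simp add: lit)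
    then have *: "definable k (core k S) (\<lambda>a. a p = 0 \<or> a q = 1)"
      by (rule core_implication[OF S pq' pq(3) pk])
    have E: "eq_or k (core k S) (fst p) (\<lambda>a. a w \<noteq> t w)" if w: "w \<in> W - {p, q}" for w
    proof -
      have "definable k S (\<lambda>a. \<exists>w\<in>{p, q, w}. a w \<noteq> t w)"
        by (rule clause_subset[OF P W]) (use pq w in auto)
      then have 1: "definable k S (\<lambda>a. a p = 0 \<or> a q = 1 \<or> a w \<noteq> t w)" by (simp add: lit)
      have wne: "w \<noteq> p" "w \<noteq> q" using w by auto
      \<comment> \<open>Conjoining the implication with its converse, obtained by swapping
        \<open>p\<close> and \<open>q\<close>, turns it into an equality while the third literal is
        kept.\<close>
      have "definable k S (\<lambda>a. (a p = 0 \<or> a q = 1 \<or> a w \<noteq> t w) \<and> (a q = 0 \<or> a p = 1 \<or> a w \<noteq> t w))"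
        using definable_conj[OF 1 definable_subst2[OF 1, of q p p q]] pq(3) pq' wne by simp
      then have "definable k S (\<lambda>a. a p = a q \<or> a w \<noteq> t w)"
      proof (rule definable_cong)
        fix a :: "svar \<Rightarrow> bit"
        show "((a p = 0 \<or> a q = 1 \<or> a w \<noteq> t w) \<and> (a q = 0 \<or> a p = 1 \<or> a w \<noteq> t w)) = (a p = a q \<or> a w \<noteq> t w)"
          by (cases "a p"; cases "a q") auto
      qed
      then have "eq_or k S (fst p) (\<lambda>a. a w \<noteq> t w)"
        by (rule eq_orI[where F = "{w}"]) (use wne pq' pq(3) in \<open>auto simp: depends_only_def\<close>)
      then have "eq_or k S (fst p) (\<lambda>a. a w = t w + 1)" unfolding bit_neq_iff .
      then have "eq_or k (core k S) (fst p) (\<lambda>a. a w = t w + 1)"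
        using w W by (intro core_eq_or_literal[OF S pk]) auto
      then show ?thesis unfolding bit_neq_iff .
    qed
    have "definable k (core k S) (\<lambda>a. (a p = 0 \<or> a q = 1) \<or> (\<exists>w\<in>W - {p, q}. a w \<noteq> t w))"
    proof (rule definable_disjs[where X = "{p}" and F = W, OF _ *])
      show "\<exists>c. (a(v := c)) p = 0 \<or> (a(v := c)) q = 1" if "v \<in> {p}" for a v
        using that by (intro exI[of _ 0]) auto
    qed (use W E pk in \<open>auto simp: depends_only_def\<close>)
    then show ?thesis
    proof (rule definable_cong)
      fix a :: "svar \<Rightarrow> bit"
      have "W = insert p (insert q (W - {p, q}))" using pq by auto
      then have "(\<exists>w\<in>W. a w \<noteq> t w) = (\<exists>w\<in>insert p (insert q (W - {p, q})). a w \<noteq> t w)" by (rule arg_cong)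
      then show "((a p = 0 \<or> a q = 1) \<or> (\<exists>w\<in>W - {p, q}. a w \<noteq> t w)) = (\<exists>w\<in>W. a w \<noteq> t w)"
        using lit by blast
    qed
  qed
qed

section \<open>Maximal relations avoiding a tuple\<close>

lemma sum_symmetric_difference:
  fixes a :: "'v \<Rightarrow> bit"
  assumes "finite A" "finite B"
  shows "sum a ((A - B) \<union> (B - A)) = sum a A + sum a B"
proof -
  have "sum a ((A - B) \<union> (B - A)) = sum a (A - B) + sum a (B - A)"
    using assms by (intro sum.union_disjoint) auto
  moreover have "sum a A = sum a (A \<inter> B) + sum a (A - B)" using sum.Int_Diff[OF assms(1)] .
  moreover have "sum a B = sum a (A \<inter> B) + sum a (B - A)"
    using sum.Int_Diff[OF assms(2), of a A] by (simp only: Int_commute)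
  ultimately show ?thesis
    by (cases "sum a (A - B)"; cases "sum a (B - A)"; cases "sum a (A \<inter> B)") simp_all
qed

text \<open>Assignments of equal parity on \<open>X\<close> differ there in an even number of
  places, so flipping two differing places at a time leads from one to the other.\<close>

lemma parity_invariant:
  fixes a b :: "svar \<Rightarrow> bit"
  assumes X: "finite X" and K: "depends_only X K"
    and flip: "\<And>a v w. K a \<Longrightarrow> v \<in> X \<Longrightarrow> w \<in> X \<Longrightarrow> v \<noteq> w \<Longrightarrow> K (a(v := a v + 1, w := a w + 1))"
  shows "sum a X = sum b X \<Longrightarrow> K a \<Longrightarrow> K b"
proof (induction "card {v \<in> X. a v \<noteq> b v}" arbitrary: a rule: less_induct)
  case less
  show ?case
  proof (cases "{v \<in> X. a v \<noteq> b v} = {}")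
    case True
    then have "K a = K b" by (intro depends_onlyD[OF K]) auto
    with less.prems show ?thesis by simp
  next
    case False
    then obtain v where v: "v \<in> X" "a v \<noteq> b v" by blast
    \<comment> \<open>A single difference would change the parity.\<close>
    have "\<exists>w\<in>X. w \<noteq> v \<and> a w \<noteq> b w"
    proof (rule ccontr)
      assume "\<not> ?thesis"
      then have "sum a X = sum (b(v := a v)) X" by (intro sum.cong) auto
      also have "\<dots> = sum b X + b v + a v" by (rule sum_upd[OF X v(1)])
      finally have "sum b X = sum b X + b v + a v" unfolding less.prems(1) .
      moreover have "x = x + y + z \<Longrightarrow> z = y" for x y z :: bit
        by (cases x; cases y; cases z; simp)
      ultimately show False using v(2) by blast
    qed
    then obtain w where w: "w \<in> X" "w \<noteq> v" "a w \<noteq> b w" by blast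
    let ?a = "a(v := a v + 1, w := a w + 1)"
    have fl: "x \<noteq> y \<Longrightarrow> x + 1 = y" for x y :: bit by (cases x; cases y) auto
    have eq: "?a v = b v" "?a w = b w" using fl[OF v(2)] fl[OF w(3)] w(2) by auto
    have sub: "{u \<in> X. ?a u \<noteq> b u} \<subseteq> {u \<in> X. a u \<noteq> b u} - {v}"
    proof
      fix u assume u: "u \<in> {u \<in> X. ?a u \<noteq> b u}"
      then have "u \<noteq> v" "u \<noteq> w" using eq by auto
      with u show "u \<in> {u \<in> X. a u \<noteq> b u} - {v}" by simp
    qed
    have "card {u \<in> X. ?a u \<noteq> b u} \<le> card ({u \<in> X. a u \<noteq> b u} - {v})"
      using X by (intro card_mono[OF _ sub]) auto
    also have "\<dots> < card {u \<in> X. a u \<noteq> b u}" using X v by (intro card_Diff1_less) auto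
    finally have "card {u \<in> X. ?a u \<noteq> b u} < card {u \<in> X. a u \<noteq> b u}" .
    moreover have "sum ?a X = sum b X"
    proof -
      have "sum ?a X = sum (a(v := a v + 1)) X + a w + (a w + 1)"
        using sum_upd[OF X w(1), of "a(v := a v + 1)"] w(2) by simp
      also have "\<dots> = sum a X + a v + (a v + 1) + a w + (a w + 1)"
        by (subst sum_upd[OF X v(1)]) simp
      also have "\<dots> = sum a X" by (cases "sum a X"; cases "a v"; cases "a w") simp_all
      finally show ?thesis using less.prems by simp
    qed
    ultimately show ?thesis
      using less.hyps[of ?a] flip[OF less.prems(2) v(1) w(1)] w(2) by blast
  qed
qed

lemma finite_assignments:
  assumes "finite W" shows "finite {r :: svar \<Rightarrow> bit. \<forall>v. v \<notin> W \<longrightarrow> r v = 0}"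
proof -
  have "x \<in> {0, 1}" for x :: bit by (cases x) auto
  then have "{r :: svar \<Rightarrow> bit. \<forall>v. v \<notin> W \<longrightarrow> r v = 0}
      \<subseteq> {r. \<forall>v. (v \<in> W \<longrightarrow> r v \<in> {0, 1}) \<and> (v \<notin> W \<longrightarrow> r v = 0)}" by blast
  then show ?thesis by (rule finite_subset) (rule finite_set_of_finite_funs, use assms in auto)
qed

text \<open>Competitors in \<open>max\<close> depend on the finite set \<open>W\<close> only, so
  they are finitely many as predicates and a maximal one exists. \<open>isolated\<close> passes from
  a relation to every larger one, hence survives the enlargement.\<close>

locale maximal_avoiding =
  fixes k :: nat and S :: "srel set" and W :: "svar set" and P :: "(svar \<Rightarrow> bit) \<Rightarrow> bool"
    and t :: "svar \<Rightarrow> bit"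
  assumes S: "S \<subseteq> srels k" and W: "finite W" "fst ` W \<subseteq> {1..k}"
    and P: "definable k S P" "depends_only W P" and Pt: "\<not> P t"
    and isolated: "v \<in> W \<Longrightarrow> P (t(v := t v + 1))"
    and max: "definable k S Q \<Longrightarrow> depends_only W Q \<Longrightarrow> (\<And>a. P a \<Longrightarrow> Q a) \<Longrightarrow> \<not> Q t \<Longrightarrow> Q a \<Longrightarrow> P a"
begin

text \<open>The witness consists of unary maps, one per coordinate, that take \<open>P\<close> into \<open>P\<close> and \<open>s\<close> to
  \<open>t\<close>. The tuples of values of all maps preserving \<open>P\<close> form a relation of the closed set (it is
  an intersection of substitution instances of \<open>P\<close>); its image under evaluation at \<open>s\<close> contains
  \<open>P\<close> by the constant maps and \<open>s\<close> by the identity, hence also \<open>t\<close> by maximality.\<close>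

lemma unary_maps:
  assumes s: "\<not> P s"
  shows "\<exists>g. \<forall>r. P r \<longrightarrow> P (\<lambda>v. if r v = s v then t v else g v)"
proof -
  \<comment> \<open>Shifting names by \<open>M\<close>, which exceeds every name in
    \<open>W\<close>, gives a second copy of the variables disjoint from \<open>W\<close>.\<close>
  define M where "M = Suc (Max (insert 0 (snd ` W)))"
  define fr :: "svar \<Rightarrow> svar" where "fr v = (fst v, snd v + M)" for v
  have "snd v < M" if "v \<in> W" for v
    unfolding M_def using that W(1) by (intro le_imp_less_Suc Max_ge) auto
  then have fr: "fst (fr v) = fst v" "fr v \<notin> W" for v by (fastforce simp: fr_def)+
  have frinj: "inj fr" by (rule injI) (simp add: fr_def prod_eq_iff)
  have frW: "v \<notin> fr ` W" if "v \<in> W" for v using fr(2) that by blast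
  define R where "R = {r. P r \<and> (\<forall>v. v \<notin> W \<longrightarrow> r v = 0)}"
  have finR: "finite R"
    by (rule finite_subset[OF _ finite_assignments[OF W(1)]]) (auto simp: R_def)
  \<comment> \<open>An assignment codes the tables of the maps: for \<open>v\<close> in
    \<open>W\<close>, \<open>a v\<close> is the image of \<open>s v\<close> and
    \<open>a (fr v)\<close> that of the other value, so \<open>\<lambda>v. a (\<rho> r v)\<close> is
    the image of \<open>r\<close>. \<open>F\<close> says that the maps preserve \<open>P\<close>;
    \<open>Q\<close> keeps only the image of \<open>s\<close>.\<close>
  define \<rho> where "\<rho> r v = (if r v = s v then v else fr v)" for r :: "svar \<Rightarrow> bit" and v
  define F where "F a = (\<forall>r\<in>R. P (\<lambda>v. a (\<rho> r v)))" for a :: "svar \<Rightarrow> bit"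
  define Q where "Q a = (\<exists>b. (\<forall>v. v \<notin> fr ` W \<longrightarrow> b v = a v) \<and> F b)" for a :: "svar \<Rightarrow> bit"
  have "definable k S F"
    unfolding F_def
  proof (rule definable_conjs[OF finR])
    fix r show "definable k S (\<lambda>a. P (\<lambda>v. a (\<rho> r v)))"
      by (rule definable_rename[OF P(1)]) (simp add: \<rho>_def fr)
  qed
  then have "definable k S Q"
    unfolding Q_def by (intro definable_exs) (use W fr in auto)
  moreover have "depends_only W Q"
  proof -
    have "Q a'" if aa: "\<forall>v\<in>W. a v = a' v" and "Q a" for a a'
    proof -
      obtain b where b: "\<And>v. v \<notin> fr ` W \<Longrightarrow> b v = a v" "F b" using \<open>Q a\<close> unfolding Q_def by blast
      define b' where "b' v = (if v \<in> W \<union> fr ` W then b v else a' v)" for v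
      have "P (\<lambda>v. b' (\<rho> r v)) = P (\<lambda>v. b (\<rho> r v))" for r
        by (rule depends_onlyD[OF P(2)]) (auto simp: b'_def \<rho>_def)
      then have "F b'" using b(2) unfolding F_def by simp
      moreover have "b' v = a' v" if "v \<notin> fr ` W" for v
        using that b(1) aa unfolding b'_def by auto
      ultimately show ?thesis unfolding Q_def by blast
    qed
    then show ?thesis unfolding depends_only_def by metis
  qed
  moreover have "Q a" if "P a" for a
  proof -
    \<comment> \<open>The constant maps: both table entries at \<open>v\<close> are
      \<open>a v\<close>.\<close>
    define b where "b w = (if w \<in> fr ` W then a (inv fr w) else a w)" for w
    have "b (\<rho> r v) = a v" if "v \<in> W" for r v
      using frW[OF that] that inv_f_f[OF frinj] by (simp add: b_def \<rho>_def)
    then have "P (\<lambda>v. b (\<rho> r v)) = P a" for r by (intro depends_onlyD[OF P(2)])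
    then have "F b" using that unfolding F_def by simp
    then show ?thesis unfolding Q_def by (intro exI[of _ b]) (simp add: b_def)
  qed
  moreover have "Q s"
  proof -
    \<comment> \<open>The identity: the entry for the value other than \<open>s v\<close> is
      \<open>s v + 1\<close>.\<close>
    define b where "b w = (if w \<in> fr ` W then s (inv fr w) + 1 else s w)" for w
    have "x \<noteq> y \<Longrightarrow> y + 1 = x" for x y :: bit by (cases x; cases y) auto
    then have "b (\<rho> r v) = r v" if "v \<in> W" for r v
      using frW[OF that] that inv_f_f[OF frinj] by (simp add: b_def \<rho>_def)
    then have "P (\<lambda>v. b (\<rho> r v)) = P r" for r by (intro depends_onlyD[OF P(2)])
    then have "F b" unfolding F_def R_def by simp
    then show ?thesis unfolding Q_def by (intro exI[of _ b]) (simp add: b_def)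
  qed
  ultimately have "Q t" using max[of Q s] s by blast
  then obtain b where b: "\<And>v. v \<notin> fr ` W \<Longrightarrow> b v = t v" "F b" unfolding Q_def by blast
  have "P (\<lambda>v. if r v = s v then t v else b (fr v))" if "P r" for r
  proof -
    define r0 where "r0 v = (if v \<in> W then r v else 0)" for v
    have "P r0 = P r" by (rule depends_onlyD[OF P(2)]) (simp add: r0_def)
    then have "r0 \<in> R" using that by (simp add: R_def r0_def)
    then have "P (\<lambda>v. b (\<rho> r0 v))" using b(2) by (simp add: F_def)
    moreover have "P (\<lambda>v. b (\<rho> r0 v)) = P (\<lambda>v. if r v = s v then t v else b (fr v))"
    proof (rule depends_onlyD[OF P(2)])
      fix v assume "v \<in> W"
      then have "b v = t v" using fr(2) by (intro b(1)) auto
      with \<open>v \<in> W\<close> show "b (\<rho> r0 v) = (if r v = s v then t v else b (fr v))"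
        by (simp add: \<rho>_def r0_def)
    qed
    ultimately show ?thesis by simp
  qed
  then show ?thesis by (intro exI[of _ "\<lambda>v. b (fr v)"]) simp
qed

text \<open>If \<open>g\<close> differs from \<open>t\<close> throughout \<open>W\<close>, each
  unary map is the bijection adding \<open>s v + t v\<close>, which is the claim. A coordinate with
  \<open>g v0 = t v0\<close> would be constant and is refuted by the neighbour of \<open>t\<close>
  at \<open>v0\<close>.\<close>

lemma translate:
  assumes s: "\<not> P s" and r: "P r"
  shows "P (\<lambda>v. r v + s v + t v)"
proof -
  obtain g where g: "\<And>r. P r \<Longrightarrow> P (\<lambda>v. if r v = s v then t v else g v)"
    using unary_maps[OF s] by blast
  show ?thesis
  proof (cases "\<exists>v0\<in>W. g v0 = t v0")
    case True
    then obtain v0 where v0: "v0 \<in> W" "g v0 = t v0" by blast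
    define u where "u r v = (if r v = s v then t v else g v)" for r v
    \<comment> \<open>At \<open>v0\<close> the map is constantly \<open>t v0\<close>, which repairs
      the flipped entry. At every other coordinate the second iterate fixes \<open>t v\<close>,
      whether the map is constant or a translation. Hence the result is \<open>t\<close>.\<close>
    have "P (u (u (t(v0 := t v0 + 1))))"
      unfolding u_def[abs_def] by (intro g isolated v0)
    moreover have "P (u (u (t(v0 := t v0 + 1)))) = P t"
    proof (rule depends_onlyD[OF P(2)])
      fix v
      show "u (u (t(v0 := t v0 + 1))) v = t v"
      proof (cases "v = v0")
        case True
        then show ?thesis using v0(2) by (simp add: u_def)
      next
        case False
        then show ?thesis by (cases "t v"; cases "s v"; cases "g v") (simp_all add: u_def)
      qed
    qed
    ultimately show ?thesis using Pt by simp
  next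
    case False
    have "P (\<lambda>v. if r v = s v then t v else g v) = P (\<lambda>v. r v + s v + t v)"
    proof (rule depends_onlyD[OF P(2)])
      fix v assume "v \<in> W"
      with False have "g v \<noteq> t v" by blast
      then show "(if r v = s v then t v else g v) = r v + s v + t v"
        by (cases "r v"; cases "s v"; cases "t v"; cases "g v") auto
    qed
    with g[OF r] show ?thesis by simp
  qed
qed

section \<open>Projections of the complement and parity sets\<close>

definition co_proj :: "svar set \<Rightarrow> (svar \<Rightarrow> bit) \<Rightarrow> bool" where
  "co_proj X a \<longleftrightarrow> (\<exists>b. (\<forall>v\<in>X. b v = a v) \<and> \<not> P b)"

text \<open>By \<open>translate\<close>, adding \<open>b + t\<close> takes \<open>P\<close> into
  itself. This operation is an involution, so it also preserves the complement; applying it for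
  \<open>b\<close> and then for \<open>c\<close> cancels the two occurrences of
  \<open>t\<close>.\<close>

lemma complement_affine:
  assumes "\<not> P a" "\<not> P b" "\<not> P c"
  shows "\<not> P (\<lambda>v. a v + b v + c v)"
proof -
  have 1: "\<not> P (\<lambda>v. a v + b v + t v)" if "\<not> P a" "\<not> P b" for a b
  proof
    assume "P (\<lambda>v. a v + b v + t v)"
    from translate[OF that(2) this] have "P (\<lambda>v. a v + b v + t v + b v + t v)" .
    moreover have "a v + b v + t v + b v + t v = a v" for v
      by (cases "a v"; cases "b v"; cases "t v") simp_all
    ultimately show False using that by simp
  qed
  have "a v + b v + t v + c v + t v = a v + b v + c v" for v
    by (cases "a v"; cases "b v"; cases "c v"; cases "t v") simp_all
  with 1[OF 1[OF assms(1,2)] assms(3)] show ?thesis by simp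
qed

lemma co_proj_affine:
  assumes "co_proj X a" "co_proj X b" "co_proj X c"
  shows "co_proj X (\<lambda>v. a v + b v + c v)"
proof -
  obtain a' b' c' where *: "\<forall>v\<in>X. a' v = a v" "\<not> P a'" "\<forall>v\<in>X. b' v = b v" "\<not> P b'"
    "\<forall>v\<in>X. c' v = c v" "\<not> P c'" using assms unfolding co_proj_def by blast
  show ?thesis unfolding co_proj_def
    by (rule exI[of _ "\<lambda>v. a' v + b' v + c' v"]) (use * complement_affine in simp)
qed

lemma depends_only_co_proj: "depends_only X (co_proj X)"
  unfolding depends_only_def co_proj_def by simp

lemma co_proj_mono: "co_proj Y a \<Longrightarrow> X \<subseteq> Y \<Longrightarrow> co_proj X a"
  unfolding co_proj_def by blast

lemma co_proj_t: "co_proj X t"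
  unfolding co_proj_def using Pt by blast

lemma co_proj_W: "co_proj W a \<longleftrightarrow> \<not> P a"
  unfolding co_proj_def using depends_onlyD[OF P(2)] by metis

lemma definable_co_proj:
  assumes "X \<subseteq> W" shows "definable k S (\<lambda>a. \<not> co_proj X a)"
proof -
  have "definable k S (\<lambda>a. \<forall>b. (\<forall>v. v \<notin> W - X \<longrightarrow> b v = a v) \<longrightarrow> P b)"
    by (rule definable_alls[OF _ _ P(1)]) (use W in auto)
  then show ?thesis
  proof (rule definable_cong)
    fix a :: "svar \<Rightarrow> bit"
    have "P b" if "\<forall>b. (\<forall>v. v \<notin> W - X \<longrightarrow> b v = a v) \<longrightarrow> P b" "\<forall>v\<in>X. b v = a v" for b
    proof -
      have "P (\<lambda>v. if v \<in> W - X then b v else a v)" by (rule that(1)[rule_format]) auto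
      moreover have "P (\<lambda>v. if v \<in> W - X then b v else a v) = P b"
        by (rule depends_onlyD[OF P(2)]) (use that(2) in auto)
      ultimately show ?thesis by simp
    qed
    moreover have "P b" if "\<not> co_proj X a" "\<forall>v. v \<notin> W - X \<longrightarrow> b v = a v" for b
      using that unfolding co_proj_def by blast
    ultimately show "(\<forall>b. (\<forall>v. v \<notin> W - X \<longrightarrow> b v = a v) \<longrightarrow> P b) = (\<not> co_proj X a)"
      unfolding co_proj_def by blast
  qed
qed

text \<open>When the complement is the coset \<open>t + V\<close>, these sets are the
  inclusion-minimal supports of nonzero vectors orthogonal to \<open>V\<close>, in other words the
  circuits of a binary matroid. This is the source of their incomparability and of the symmetric
  differences below.\<close>

definition parity_set :: "svar set \<Rightarrow> bool" where
  "parity_set X \<longleftrightarrow> X \<subseteq> W \<and> X \<noteq> {} \<and> (\<forall>a. co_proj X a \<longleftrightarrow> sum a X = sum t X)"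

lemma parity_setD: "parity_set X \<Longrightarrow> X \<subseteq> W" "parity_set X \<Longrightarrow> X \<noteq> {}" "parity_set X \<Longrightarrow> finite X"
  "parity_set X \<Longrightarrow> fst ` X \<subseteq> {1..k}" "parity_set X \<Longrightarrow> co_proj X a \<longleftrightarrow> sum a X = sum t X"
  unfolding parity_set_def using W finite_subset[of X W] by (auto dest: image_mono)

text \<open>A smallest subset \<open>X\<close> of \<open>Z\<close> whose projection still misses
  \<open>x\<close> works. All neighbours of \<open>x\<close> on \<open>X\<close> lie in that
  projection, and being affine it is therefore closed under flipping two coordinates, so it is a
  union of parity classes; the class of \<open>x\<close> is absent and the other one is
  present.\<close>

lemma parity_set_exists:
  assumes "Z \<subseteq> W" "\<not> co_proj Z x"
  shows "\<exists>X. parity_set X \<and> X \<subseteq> Z \<and> sum x X \<noteq> sum t X"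
proof -
  obtain X where X: "X \<subseteq> Z" "\<not> co_proj X x" and least: "\<And>Y. Y \<subseteq> Z \<Longrightarrow> \<not> co_proj Y x \<Longrightarrow> card X \<le> card Y"
  proof -
    have "\<exists>X. (X \<subseteq> Z \<and> \<not> co_proj X x) \<and> (\<forall>Y. Y \<subseteq> Z \<and> \<not> co_proj Y x \<longrightarrow> card X \<le> card Y)"
      by (rule ex_has_least_nat[of _ Z]) (use assms in simp)
    then show thesis using that by auto
  qed
  have XW: "X \<subseteq> W" using X assms by simp
  then have XW: "X \<subseteq> W" "finite X" using W(1) finite_subset by auto
  have fl: "y \<noteq> z \<Longrightarrow> y = z + 1" for y z :: bit by (cases y; cases z) auto
  \<comment> \<open>By minimality \<open>x\<close> extends from \<open>X - {v}\<close> to a tuple of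
    the complement, which must disagree with \<open>x\<close> at \<open>v\<close>.\<close>
  have nb: "co_proj X (x(v := x v + 1))" if v: "v \<in> X" for v
  proof -
    have "card (X - {v}) < card X" using XW(2) v by (rule card_Diff1_less)
    then have "co_proj (X - {v}) x" using least[of "X - {v}"] X(1) by fastforce
    then obtain b where b: "\<forall>w\<in>X - {v}. b w = x w" "\<not> P b" unfolding co_proj_def by blast
    have "b v \<noteq> x v" using b X(2) unfolding co_proj_def by blast
    from fl[OF this] b(1) have "\<forall>w\<in>X. b w = (x(v := x v + 1)) w" by simp
    with b(2) show ?thesis unfolding co_proj_def by blast
  qed
  have "X \<noteq> {}" using X(2) co_proj_t unfolding co_proj_def by blast
  then obtain v where v: "v \<in> X" by blast
  have flip: "co_proj X (a(v := a v + 1, w := a w + 1))" if "co_proj X a" "v \<in> X" "w \<in> X" "v \<noteq> w" for a v w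
  proof -
    have "(\<lambda>u. a u + (x(v := x v + 1)) u + (x(w := x w + 1)) u) = a(v := a v + 1, w := a w + 1)"
    proof
      fix u
      have "y + z + z = y" "y + (z + 1) + z = y + 1" "y + z + (z + 1) = y + 1" for y z :: bit
        by (cases y; cases z; simp)+
      then show "a u + (x(v := x v + 1)) u + (x(w := x w + 1)) u = (a(v := a v + 1, w := a w + 1)) u"
        using that(4) by (simp del: add_bit_eq_xor)
    qed
    with co_proj_affine[OF that(1) nb[OF that(2)] nb[OF that(3)]] show ?thesis by simp
  qed
  have par: "co_proj X a \<Longrightarrow> sum a X = sum b X \<Longrightarrow> co_proj X b" for a b
    by (rule parity_invariant[OF XW(2) depends_only_co_proj flip])
  have xv: "sum (x(v := x v + 1)) X = sum x X + 1"
    by (subst sum_upd[OF XW(2) v]) (cases "sum x X"; cases "x v"; simp)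
  have iff: "co_proj X a \<longleftrightarrow> sum a X = sum x X + 1" for a
  proof
    assume "sum a X = sum x X + 1"
    then show "co_proj X a" using par[OF nb[OF v]] xv by simp
  next
    assume "co_proj X a"
    then have "sum a X \<noteq> sum x X" using par X(2) by blast
    then show "sum a X = sum x X + 1" by (rule fl)
  qed
  have tX: "sum t X = sum x X + 1" using iff co_proj_t by blast
  then have "sum x X \<noteq> sum t X" by (cases "sum x X") auto
  moreover have "parity_set X" unfolding parity_set_def using iff tX XW \<open>X \<noteq> {}\<close> by simp
  ultimately show ?thesis using X(1) by blast
qed

lemma P_iff_parity_set: "P x \<longleftrightarrow> (\<exists>X. parity_set X \<and> sum x X \<noteq> sum t X)"
proof
  assume "P x"
  then show "\<exists>X. parity_set X \<and> sum x X \<noteq> sum t X" using parity_set_exists[of W x] co_proj_W by blast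
next
  assume "\<exists>X. parity_set X \<and> sum x X \<noteq> sum t X"
  then obtain X where X: "parity_set X" "sum x X \<noteq> sum t X" by blast
  then have "\<not> co_proj X x" using parity_setD(5) by blast
  then show "P x" unfolding co_proj_def by blast
qed

lemma definable_parity_set:
  assumes "parity_set X" shows "definable k S (\<lambda>a. sum a X = sum t X + 1)"
  using definable_co_proj[OF parity_setD(1)[OF assms]]
proof (rule definable_cong)
  fix a show "(\<not> co_proj X a) = (sum a X = sum t X + 1)"
    using parity_setD(5)[OF assms] bit_neq_iff by metis
qed

text \<open>If \<open>X\<close> were properly contained in \<open>Y\<close>, a variable of
  \<open>Y - X\<close> could absorb the parity of \<open>Y\<close>, leaving the values on
  \<open>X\<close> unrestricted, against the parity condition on \<open>X\<close>.\<close>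

lemma parity_set_incomparable:
  assumes X: "parity_set X" and Y: "parity_set Y" and sub: "X \<subseteq> Y"
  shows "X = Y"
proof (rule ccontr)
  assume "X \<noteq> Y"
  then obtain v where v: "v \<in> Y" "v \<notin> X" using sub by blast
  obtain x where x: "x \<in> X" using parity_setD(2)[OF X] by blast
  let ?a = "t(x := t x + 1)"
  obtain c where "sum (?a(v := c)) Y = sum t Y" using sum_solve[OF parity_setD(3)[OF Y] v(1)] by blast
  then have "co_proj X (?a(v := c))" using parity_setD(5)[OF Y] co_proj_mono sub by blast
  then have "sum (?a(v := c)) X = sum t X" using parity_setD(5)[OF X] by blast
  then have "sum ?a X = sum t X" using sum_upd_notin[OF v(2), of ?a c] by simp
  then have "sum t X + t x + (t x + 1) = sum t X"
    unfolding sum_upd[OF parity_setD(3)[OF X] x] .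
  moreover have "y + z + (z + 1) \<noteq> y" for y z :: bit by (cases y; cases z; simp)
  ultimately show False by blast
qed

text \<open>A parity set \<open>X \<subseteq> X0 \<union> Q\<close> other than \<open>Q\<close> with \<open>X - Q\<close> as small as possible satisfies: the
  projection of the complement to \<open>Q \<union> X\<close> is cut out by the parities of \<open>Q\<close> and \<open>X\<close> alone.\<close>

lemma parity_set_pair:
  assumes X0: "parity_set X0" "\<And>x. X0 \<noteq> {x}" and Q: "parity_set Q" "Q \<noteq> X0"
  shows "\<exists>p\<in>X0. eq_or k S (fst p) (\<lambda>a. sum a Q = sum t Q + 1)"
proof -
  obtain X where X: "parity_set X" "X \<noteq> Q" "X \<subseteq> X0 \<union> Q"
    and least: "\<And>Y. parity_set Y \<Longrightarrow> Y \<noteq> Q \<Longrightarrow> Y \<subseteq> X0 \<union> Q \<Longrightarrow> card (X - Q) \<le> card (Y - Q)"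
  proof -
    have "\<exists>X. (parity_set X \<and> X \<noteq> Q \<and> X \<subseteq> X0 \<union> Q) \<and>
      (\<forall>Y. parity_set Y \<and> Y \<noteq> Q \<and> Y \<subseteq> X0 \<union> Q \<longrightarrow> card (X - Q) \<le> card (Y - Q))"
      by (rule ex_has_least_nat[of _ X0]) (use X0(1) Q(2) in auto)
    then show thesis using that by auto
  qed
  note fX = parity_setD(3)[OF X(1)] and fQ = parity_setD(3)[OF Q(1)]
  have QX: "co_proj (Q \<union> X) a \<longleftrightarrow> sum a Q = sum t Q \<and> sum a X = sum t X" for a
  proof
    assume "co_proj (Q \<union> X) a"
    then have "co_proj Q a" "co_proj X a" using co_proj_mono by blast+
    then show "sum a Q = sum t Q \<and> sum a X = sum t X" using parity_setD(5) Q(1) X(1) by blast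
  next
    assume a: "sum a Q = sum t Q \<and> sum a X = sum t X"
    show "co_proj (Q \<union> X) a"
    proof (rule ccontr)
      assume "\<not> co_proj (Q \<union> X) a"
      then obtain Z where Z: "parity_set Z" "Z \<subseteq> Q \<union> X" "sum a Z \<noteq> sum t Z"
        using parity_set_exists[of "Q \<union> X" a] parity_setD(1) Q(1) X(1) by blast
      note fZ = parity_setD(3)[OF Z(1)]
      have "Z \<noteq> Q" "Z \<noteq> X" using a Z(3) by auto
      then have "card (X - Q) \<le> card (Z - Q)" using least Z X(3) by blast
      then have "Z - Q = X - Q" using Z(2) fX by (intro card_seteq) auto
      \<comment> \<open>Every tuple of the complement has the parity of \<open>t\<close> on
        \<open>D\<close>, because it does on \<open>Z\<close> and on \<open>X\<close>. As
        \<open>D\<close> lies in \<open>Q\<close>, where the total parity is the only restriction,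
        \<open>D\<close> must be \<open>Q\<close>; so the parity of \<open>Z\<close> follows from
        those of \<open>Q\<close> and \<open>X\<close>.\<close>
      define D where "D = (Z - X) \<union> (X - Z)"
      have D: "D \<subseteq> Q" "D \<noteq> {}" using \<open>Z - Q = X - Q\<close> \<open>Z \<noteq> X\<close> unfolding D_def by auto
      have sD: "sum b D = sum b Z + sum b X" for b :: "svar \<Rightarrow> bit"
        unfolding D_def by (rule sum_symmetric_difference[OF fZ fX])
      have "D = Q"
      proof (rule ccontr)
        assume "D \<noteq> Q"
        then obtain e where e: "e \<in> Q" "e \<notin> D" using D by blast
        obtain d where d: "d \<in> D" using D by blast
        let ?a = "t(d := t d + 1)"
        obtain c where c: "sum (?a(e := c)) Q = sum t Q" using sum_solve[OF fQ e(1)] by blast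
        then have "co_proj Q (?a(e := c))" using parity_setD(5)[OF Q(1)] by blast
        then obtain b where b: "\<forall>v\<in>Q. b v = (?a(e := c)) v" "\<not> P b" unfolding co_proj_def by blast
        then have "co_proj Y b" for Y unfolding co_proj_def by blast
        then have "sum b Z = sum t Z" "sum b X = sum t X" using parity_setD(5) Z(1) X(1) by blast+
        then have "sum b D = sum t D" using sD by simp
        moreover have "sum b D = sum (?a(e := c)) D" using b(1) D(1) by (intro sum.cong) auto
        moreover have "\<dots> = sum ?a D" by (rule sum_upd_notin[OF e(2)])
        moreover have "\<dots> = sum t D + t d + (t d + 1)"
          by (rule sum_upd[OF finite_subset[OF D(1) fQ] d])
        moreover have "y + z + (z + 1) \<noteq> y" for y z :: bit by (cases y; cases z; simp)
        ultimately show False by metis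
      qed
      then have "sum a Z + sum a X = sum t Z + sum t X" using sD[of a] sD[of t] a by simp
      then show False using a Z(3) by (cases "sum a Z"; cases "sum t Z"; cases "sum t X") auto
    qed
  qed
  let ?bX = "sum t X + 1" let ?bQ = "sum t Q + 1"
  let ?R = "\<lambda>a :: svar \<Rightarrow> bit. sum a Q = ?bQ \<or> sum a X = ?bX"
  have LX: "definable k S (\<lambda>a. sum a X = ?bX)" and LQ: "definable k S (\<lambda>a. sum a Q = ?bQ)"
    using definable_parity_set X(1) Q(1) by auto
  have "definable k S (\<lambda>a. \<not> co_proj (Q \<union> X) a)" using parity_setD(1) Q(1) X(1) by (intro definable_co_proj) blast
  then have R: "definable k S ?R"
  proof (rule definable_cong)
    fix a show "(\<not> co_proj (Q \<union> X) a) = ?R a" unfolding QX using bit_neq_iff by metis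
  qed
  obtain p where p: "p \<in> X" "p \<notin> Q" using parity_set_incomparable[OF X(1) Q(1)] X(2) by blast
  have pX0: "p \<in> X0" using p X(3) by blast
  have pk: "fst p \<in> {1..k}" using parity_setD(4)[OF X(1)] p by auto
  obtain p' where p': "fst p' = fst p" "p' \<notin> W" using fresh_var W(1) by blast
  have p'X: "p' \<notin> X" "p' \<notin> Q" "p' \<noteq> p" using p' parity_setD(1) X(1) Q(1) p by blast+
  have sp: "sum (a(p := c)) Q = sum a Q" "sum (a(p := c)) X = sum a X + a p + c" for a :: "svar \<Rightarrow> bit" and c
    using sum_upd_notin[OF p(2)] sum_upd[OF fX p(1)] by auto
  have "eq_or k S (fst p) (\<lambda>a. sum a Q = ?bQ)"
  proof (cases "X - Q = {p}")
    case False
    then obtain z where z: "z \<in> X" "z \<notin> Q" "z \<noteq> p" using p by blast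
    have zk: "fst z \<in> {1..k}" using parity_setD(4)[OF X(1)] z by auto
    \<comment> \<open>The variable \<open>z\<close> occurs in \<open>X\<close> but not in
      \<open>Q\<close>, so quantifying it solves the equation over \<open>X\<close> for
      \<open>p\<close>. The same equation with \<open>p'\<close> then holds exactly when
      \<open>a p = a p'\<close>, and the only alternative is the equation over
      \<open>Q\<close>.\<close>
    have "definable k S (\<lambda>a. sum a X = ?bX \<and> ?R (a(p := a p')))"
      by (rule definable_conj[OF LX definable_subst[OF R p'(1)]])
    from definable_ex[OF this zk] have
      "definable k S (\<lambda>a. \<exists>c. sum (a(z := c)) X = ?bX \<and> ?R ((a(z := c))(p := (a(z := c)) p')))" .
    then have "definable k S (\<lambda>a. a p = a p' \<or> sum a Q = ?bQ)"
    proof (rule definable_cong)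
      fix a :: "svar \<Rightarrow> bit"
      have ne: "(a(z := c)) p = a p" "(a(z := c)) p' = a p'" for c using z p'X by auto
      have sQ: "sum (a(z := c)) Q = sum a Q" for c by (rule sum_upd_notin[OF z(2)])
      obtain c where c: "sum (a(z := c)) X = ?bX" using sum_solve[OF fX z(1)] by blast
      have "(?bX + x + y = ?bX) = (x = y)" for x y
        by (cases "sum t X"; cases x; cases y) simp_all
      with c show "(\<exists>c. sum (a(z := c)) X = ?bX \<and> ?R ((a(z := c))(p := (a(z := c)) p')))
         = (a p = a p' \<or> sum a Q = ?bQ)"
        unfolding sp ne sQ by metis
    qed
    then show ?thesis
      by (rule eq_orI[OF _ depends_only_sum]) (use p p' p'X in auto)
  next
    case True
    \<comment> \<open>Here \<open>X0\<close> having more than one variable is essential: a singleton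
      \<open>{p}\<close> inside \<open>X0\<close> would equal \<open>X0\<close> by
      incomparability.\<close>
    have "X \<noteq> {p}" using parity_set_incomparable[OF X(1) X0(1)] pX0 X0(2) by blast
    then obtain q where q: "q \<in> X" "q \<noteq> p" "q \<in> Q" using True p by blast
    obtain r where r: "r \<in> Q" "r \<notin> X" using parity_set_incomparable[OF Q(1) X(1)] X(2) by blast
    have rp: "r \<noteq> p" using r p by blast
    have qr: "q \<noteq> r" using q r by blast
    have qk: "fst q \<in> {1..k}" and rk: "fst r \<in> {1..k}" using parity_setD(4)[OF Q(1)] q r by auto
    define Z where "Z = (X - Q) \<union> (Q - X)"
    have Z: "finite Z" "p \<in> Z" "r \<in> Z" "q \<notin> Z" using fX fQ p q r unfolding Z_def by auto
    have sZ: "sum a Z = sum a X + sum a Q" for a :: "svar \<Rightarrow> bit"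
      unfolding Z_def by (rule sum_symmetric_difference[OF fX fQ])
    let ?bZ = "sum t Z + 1"
    \<comment> \<open>Flipping \<open>q\<close> flips both sums. Hence one of the equations holds
      for each value of \<open>q\<close> exactly when they are solved by opposite values, and this
      is a single equation over the symmetric difference \<open>Z\<close>.\<close>
    have "definable k S (\<lambda>a. \<forall>c. ?R (a(q := c)))" by (rule definable_all[OF R qk])
    then have LZ: "definable k S (\<lambda>a. sum a Z = ?bZ)"
    proof (rule definable_cong)
      fix a :: "svar \<Rightarrow> bit"
      have s: "sum (a(q := c)) X = sum a X + a q + c" "sum (a(q := c)) Q = sum a Q + a q + c" for c
        by (rule sum_upd[OF fX q(1)], rule sum_upd[OF fQ q(3)])
      have ex: "(\<forall>c. B c) \<longleftrightarrow> B 0 \<and> B 1" for B :: "bit \<Rightarrow> bool" by (metis bit.exhaust)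
      have "(\<forall>c. y + z + c = v + 1 \<or> x + z + c = u + 1) = (x + y = u + v + 1)" for x y z u v :: bit
        unfolding ex by (cases x; cases y; cases z; cases u; cases v; simp)
      then show "(\<forall>c. ?R (a(q := c))) = (sum a Z = ?bZ)" unfolding s sZ .
    qed
    obtain p'' where p'': "fst p'' = fst p" "p'' \<notin> insert p' W"
      using fresh_var[of "insert p' W"] W(1) by blast
    have p''X: "p'' \<noteq> p" "p'' \<noteq> p'" "p'' \<noteq> q" "p'' \<noteq> r" "p' \<noteq> q" "p' \<noteq> r"
      using p' p'' parity_setD(1)[OF X(1)] parity_setD(1)[OF Q(1)] p q r by blast+
    \<comment> \<open>Given the equation over \<open>X\<close>, the one over \<open>Z\<close> with
      \<open>p''\<close> makes the equation over \<open>Q\<close> equivalent to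
      \<open>a p \<noteq> a p''\<close>. So \<open>?R\<close> with \<open>p'\<close> reads
      \<open>a p = a p' \<or> a p \<noteq> a p''\<close>, which on two values is the path on
      \<open>p\<close>, \<open>p'\<close>, \<open>p''\<close>. Quantifying \<open>q\<close> and
      \<open>r\<close> makes the other two equations solvable.\<close>
    let ?G = "\<lambda>a. sum a X = ?bX \<and> ?R (a(p := a p')) \<and> sum (a(p := a p'')) Z = ?bZ"
    have "definable k S ?G"
      by (intro definable_conj LX definable_subst[OF R p'(1)] definable_subst[OF LZ p''(1)])
    from definable_exs[OF _ _ this, of "{q, r}"] have
      "definable k S (\<lambda>a. \<exists>b. (\<forall>v. v \<notin> {q, r} \<longrightarrow> b v = a v) \<and> ?G b)" using qk rk by auto
    then have path: "definable k S (\<lambda>a. a p = a p' \<or> a p' = a p'')"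
    proof (rule definable_cong)
      fix a :: "svar \<Rightarrow> bit"
      have G: "?G b \<longleftrightarrow> sum b X = ?bX \<and> sum (b(p := b p'')) Z = ?bZ \<and> (b p = b p' \<or> b p' = b p'')" for b
      proof -
        have s: "sum (b(p := b p'')) Z = sum b X + b p + b p'' + sum b Q" unfolding sZ sp ..
        have "(x = u + 1 \<and> (y = v + 1 \<or> x + c + c' = u + 1) \<and> x + c + c'' + y = u + v + 1) =
          (x = u + 1 \<and> x + c + c'' + y = u + v + 1 \<and> (c = c' \<or> c' = c''))" for x y u v c c' c'' :: bit
          by (cases x; cases y; cases u; cases v; cases c; cases c'; cases c''; simp)
        then show ?thesis unfolding s sp sZ[of t] .
      qed
      obtain c where c: "sum (a(q := c)) X = ?bX" using sum_solve[OF fX q(1)] by blast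
      obtain d where d: "sum (a(q := c, p := a p'', r := d)) Z = ?bZ" using sum_solve[OF Z(1,3)] by blast
      define b where "b = a(q := c, r := d)"
      have b: "\<forall>v. v \<notin> {q, r} \<longrightarrow> b v = a v" by (simp add: b_def)
      have bX: "sum b X = ?bX" unfolding b_def sum_upd_notin[OF r(2)] by (rule c)
      have "b(p := b p'') = a(q := c, p := a p'', r := d)"
        unfolding b_def using p''X rp q(2) by auto
      with d have bZ: "sum (b(p := b p'')) Z = ?bZ" by simp
      have same: "b' p = a p \<and> b' p' = a p' \<and> b' p'' = a p''" if "\<forall>v. v \<notin> {q, r} \<longrightarrow> b' v = a v" for b'
        using that p''X rp q(2) by (intro conjI; intro that[rule_format]) auto
      show "(\<exists>b. (\<forall>v. v \<notin> {q, r} \<longrightarrow> b v = a v) \<and> ?G b) = (a p = a p' \<or> a p' = a p'')"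
        unfolding G using b bX bZ same by metis
    qed
    have "eq_or_eq k S (fst p) (fst p)"
    proof (rule eq_or_eq_of_path[OF _ pk])
      fix x y z :: svar assume s: "fst x = fst p" "fst y = fst p" "fst z = fst p"
      let ?\<rho> = "id(p := x, p' := y, p'' := z)"
      have "definable k S (\<lambda>a. a (?\<rho> p) = a (?\<rho> p') \<or> a (?\<rho> p') = a (?\<rho> p''))"
        by (rule definable_rename[where \<rho> = ?\<rho>, OF path]) (use s p' p'' in simp)
      then show "definable k S (\<lambda>a. a x = a y \<or> a y = a z)" using p'X p''X by simp
    qed
    \<comment> \<open>The equation over \<open>X\<close> contains both \<open>p\<close> and
      \<open>q\<close>, so it carries the link from the sort of \<open>p\<close> to that of
      \<open>q\<close>, a variable of \<open>Q\<close>.\<close>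
    from eq_or_eq_imp_eq_or_lin[OF this LX fX parity_setD(4)[OF X(1)] p(1)]
    have "eq_or k S (fst p) (\<lambda>a. sum a X = ?bX)" .
    from eq_or_lin_imp_eq_or_eq[OF this fX parity_setD(4)[OF X(1)] q(1) p(1) q(2)]
    have "eq_or_eq k S (fst p) (fst q)" .
    from eq_or_eq_imp_eq_or_lin[OF this LQ fQ parity_setD(4)[OF Q(1)] q(3)] show ?thesis .
  qed
  with pX0 show ?thesis by blast
qed

text \<open>A parity set with at least two variables serves as the starting disjunct, since
  \<open>parity_set_pair\<close> links every other parity set to one of its variables. If there is
  none, \<open>P\<close> is the clause that excludes only the values of \<open>t\<close> on
  \<open>W\<close>.\<close>

lemma definable_core: "definable k (core k S) P"
proof (cases "\<forall>X. parity_set X \<longrightarrow> (\<exists>x. X = {x})")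
  case True
  have "P a \<longleftrightarrow> (\<exists>w\<in>W. a w \<noteq> t w)" for a
  proof
    assume "P a"
    then obtain X where X: "parity_set X" "sum a X \<noteq> sum t X" using P_iff_parity_set by blast
    then obtain x where "X = {x}" using True by blast
    with X parity_setD(1)[OF X(1)] show "\<exists>w\<in>W. a w \<noteq> t w" by (intro bexI[of _ x]) auto
  next
    assume "\<exists>w\<in>W. a w \<noteq> t w"
    then obtain w where w: "w \<in> W" "a w \<noteq> t w" by blast
    \<comment> \<open>Flipping \<open>w\<close> in \<open>t\<close> changes the parity only of sets
      containing \<open>w\<close>, so the singleton \<open>{w}\<close> is itself a parity
      set.\<close>
    from isolated[OF w(1)] obtain X where X: "parity_set X" "sum (t(w := t w + 1)) X \<noteq> sum t X"
      using P_iff_parity_set by blast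
    then have "w \<in> X" using sum_upd_notin by metis
    then have "X = {w}" using True X(1) by blast
    with w(2) have "sum a X \<noteq> sum t X" by (simp del: add_bit_eq_xor)
    with X(1) show "P a" using P_iff_parity_set[of a] by blast
  qed
  then have eq: "P = (\<lambda>a. \<exists>w\<in>W. a w \<noteq> t w)" by (rule ext)
  from P(1) show ?thesis unfolding eq by (rule core_clause[OF S W])
next
  case False
  then obtain X0 where X0: "parity_set X0" "\<And>x. X0 \<noteq> {x}" by blast
  let ?L = "\<lambda>X a. sum a X = sum t X + 1"
  let ?J = "{X. parity_set X} - {X0}"
  have "?J \<subseteq> Pow W" using parity_setD(1) by auto
  then have J: "finite ?J" using W(1) by (meson finite_Pow_iff finite_subset)
  have "definable k (core k S) (\<lambda>a. ?L X0 a \<or> (\<exists>Q\<in>?J. ?L Q a))"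
  proof (rule definable_disjs[where X = X0 and F = W, OF J])
    show "definable k (core k S) (?L X0)"
      by (rule core_lin[OF S parity_setD(3,2,4) definable_parity_set]) (use X0 in auto)
    show "\<exists>c. ?L X0 (a(v := c))" if "v \<in> X0" for a v
      by (rule sum_solve[OF parity_setD(3)[OF X0(1)] that])
    show "fst ` X0 \<subseteq> {1..k}" by (rule parity_setD(4)[OF X0(1)])
    fix Q assume "Q \<in> ?J"
    then have Q: "parity_set Q" "Q \<noteq> X0" by auto
    show "depends_only W (?L Q)" by (rule depends_only_mono[OF depends_only_sum parity_setD(1)[OF Q(1)]])
    obtain p where p: "p \<in> X0" "eq_or k S (fst p) (?L Q)" using parity_set_pair[OF X0 Q] by blast
    moreover have "fst p \<in> {1..k}" using parity_setD(4)[OF X0(1)] p(1) by auto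
    ultimately have "eq_or k (core k S) (fst p) (?L Q)"
      using core_eq_or_lin[OF S parity_setD(3,2,4)[OF Q(1)] _ _ definable_parity_set[OF Q(1)]] by blast
    with p(1) show "\<exists>v\<in>X0. eq_or k (core k S) (fst v) (?L Q)" by blast
  qed (rule W(1))
  then show ?thesis
  proof (rule definable_cong)
    fix a
    show "(?L X0 a \<or> (\<exists>Q\<in>?J. ?L Q a)) = P a"
      using X0(1) P_iff_parity_set[of a] unfolding bit_neq_iff by blast
  qed
qed

end

section \<open>Separation of tuples by induction on the arity\<close>

lemma core_complete:
  assumes S: "S \<subseteq> srels k"
  shows "finite W \<Longrightarrow> fst ` W \<subseteq> {1..k} \<Longrightarrow> definable k S P \<Longrightarrow> depends_only W P \<Longrightarrow> definable k (core k S) P"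
proof (induction "card W" arbitrary: W P rule: less_induct)
  case less
  note W = less.prems(1,2) and P = less.prems(3,4)
  let ?A = "{a :: svar \<Rightarrow> bit. \<forall>v. v \<notin> W \<longrightarrow> a v = 0}"
  have finA: "finite ?A" by (rule finite_assignments[OF W(1)])
  have sep: "\<exists>Q. definable k (core k S) Q \<and> depends_only W Q \<and> (\<forall>a. P a \<longrightarrow> Q a) \<and> \<not> Q t" if Pt: "\<not> P t" for t
  proof (cases "\<exists>v\<in>W. \<forall>c. \<not> P (t(v := c))")
    case True
    then obtain v where v: "v \<in> W" "\<forall>c. \<not> P (t(v := c))" by blast
    \<comment> \<open>Both values at \<open>v\<close> miss \<open>P\<close>, so projecting
      \<open>v\<close> away still excludes \<open>t\<close>, and the projection has smaller
      arity.\<close>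
    let ?Q = "\<lambda>a. \<exists>c. P (a(v := c))"
    have "definable k S ?Q" by (rule definable_ex[OF P(1)]) (use v W in auto)
    moreover have Q: "depends_only (W - {v}) ?Q"
    proof -
      have "P (a(v := c)) = P (b(v := c))" if "\<forall>w\<in>W - {v}. a w = b w" for a b c
        by (rule depends_onlyD[OF P(2)]) (use that in auto)
      then show ?thesis unfolding depends_only_def by blast
    qed
    moreover have "card (W - {v}) < card W" using W(1) v(1) by (rule card_Diff1_less)
    ultimately have "definable k (core k S) ?Q" using W by (intro less.hyps[of "W - {v}"]) auto
    moreover have "?Q a" if "P a" for a using that by (intro exI[of _ "a v"]) simp
    moreover have "depends_only W ?Q" by (rule depends_only_mono[OF Q]) blast
    ultimately show ?thesis using v(2) by blast
  next
    case False
    let ?C = "\<lambda>Q. definable k S Q \<and> depends_only W Q \<and> (\<forall>a. P a \<longrightarrow> Q a) \<and> \<not> Q t"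
    \<comment> \<open>Candidates are compared by their number of satisfying assignments that vanish
      outside \<open>W\<close>. This number is bounded, and such assignments represent all others
      because candidates depend on \<open>W\<close> only.\<close>
    have "card {a \<in> ?A. Q a} \<le> card ?A" for Q using finA by (intro card_mono) auto
    then have "\<forall>Q. ?C Q \<longrightarrow> card {a \<in> ?A. Q a} < Suc (card ?A)" by (simp add: le_imp_less_Suc)
    from Lattices_Big.ex_has_greatest_nat[OF _ this, of P] P Pt
    obtain Q where Q: "?C Q" and great: "\<And>Q'. ?C Q' \<Longrightarrow> card {a \<in> ?A. Q' a} \<le> card {a \<in> ?A. Q a}"
      by blast
    interpret maximal_avoiding k S W Q t
    proof
      show "Q (t(v := t v + 1))" if v: "v \<in> W" for v
      proof -
        obtain c where c: "P (t(v := c))" using False v by blast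
        then have "c \<noteq> t v" using Pt by auto
        then have "c = t v + 1" using bit_neq_iff by blast
        with c Q show ?thesis by blast
      qed
      fix Q' a assume Q': "definable k S Q'" "depends_only W Q'" "\<And>a. Q a \<Longrightarrow> Q' a" "\<not> Q' t" "Q' a"
      then have "card {a \<in> ?A. Q' a} \<le> card {a \<in> ?A. Q a}" using Q by (intro great) blast
      then have eq: "{a \<in> ?A. Q a} = {a \<in> ?A. Q' a}" using finA Q'(3) by (intro card_seteq) auto
      define a0 where "a0 v = (if v \<in> W then a v else 0)" for v
      have "Q' a0 = Q' a" by (rule depends_onlyD[OF Q'(2)]) (simp add: a0_def)
      then have "a0 \<in> {a \<in> ?A. Q' a}" using Q'(5) by (simp add: a0_def)
      then have "Q a0" using eq by blast
      moreover have "Q a0 = Q a" by (rule depends_onlyD[of W]) (use Q in \<open>simp_all add: a0_def\<close>)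
      ultimately show "Q a" by simp
    qed (use S W Q in auto)
    show ?thesis using definable_core Q by blast
  qed
  then obtain Q where Q: "\<And>t. \<not> P t \<Longrightarrow> definable k (core k S) (Q t)" "\<And>t. \<not> P t \<Longrightarrow> depends_only W (Q t)"
    "\<And>t a. \<not> P t \<Longrightarrow> P a \<Longrightarrow> Q t a" "\<And>t. \<not> P t \<Longrightarrow> \<not> Q t t" by metis
  \<comment> \<open>\<open>P\<close> is the conjunction of its separators; taking the excluded
    tuples among the representatives in \<open>?A\<close> keeps it finite.\<close>
  have "definable k (core k S) (\<lambda>a. \<forall>t\<in>{t \<in> ?A. \<not> P t}. Q t a)"
    by (rule definable_conjs) (use finA Q(1) in auto)
  then show ?case
  proof (rule definable_cong, intro iffI)
    fix a assume *: "\<forall>t\<in>{t \<in> ?A. \<not> P t}. Q t a"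
    define a0 where "a0 v = (if v \<in> W then a v else 0)" for v
    show "P a"
    proof (rule ccontr)
      assume "\<not> P a"
      moreover have "P a0 = P a" by (rule depends_onlyD[OF P(2)]) (simp add: a0_def)
      ultimately have a0: "\<not> P a0" by simp
      then have "Q a0 a" using * by (simp add: a0_def)
      moreover have "Q a0 a = Q a0 a0" by (rule depends_onlyD[OF Q(2)[OF a0]]) (simp add: a0_def)
      ultimately show False using Q(4)[OF a0] by simp
    qed
  qed (use Q(3) in blast)
qed

lemma fm_over_mono: "fm_over k T f \<Longrightarrow> T \<subseteq> T' \<Longrightarrow> fm_over k T' f"
  by (induction f) auto

lemma definable_mono:
  assumes "definable k T P" "T \<subseteq> T'" shows "definable k T' P"
proof -
  have "T \<union> {sigma_bot} \<union> sigma_eq ` {1..k} \<subseteq> T' \<union> {sigma_bot} \<union> sigma_eq ` {1..k}"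
    using assms(2) by blast
  then show ?thesis using assms(1) fm_over_mono unfolding definable_def by blast
qed

lemma qppE:
  assumes "R \<in> qpp k T"
  obtains vs P where "R = rel_on vs P" "distinct vs" "fst ` set vs \<subseteq> {1..k}" "definable k T P" "depends_only (set vs) P"
  using assms depends_only_mono[OF depends_only_sat] unfolding qpp_def definable_def by blast

theorem theorem3p2:
  fixes k :: nat and S :: "srel set"
  assumes "S \<subseteq> srels k"
  shows "qpp k S = qpp k (qpp k S \<inter> CR k)"
proof (intro equalityI subsetI)
  fix R assume "R \<in> qpp k S"
  then obtain vs P where R: "R = rel_on vs P" "distinct vs" "fst ` set vs \<subseteq> {1..k}" "definable k S P" "depends_only (set vs) P"
    by (rule qppE)
  have "qpp k S \<inter> CR k \<subseteq> srels k" using qpp_srels by blast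
  moreover have "definable k (qpp k S \<inter> CR k) P" using core_complete[OF assms _ R(3-5)] by simp
  ultimately show "R \<in> qpp k (qpp k S \<inter> CR k)" unfolding R(1) using R by (intro qpp_rel_on)
next
  fix R assume "R \<in> qpp k (qpp k S \<inter> CR k)"
  then obtain vs P where R: "R = rel_on vs P" "distinct vs" "fst ` set vs \<subseteq> {1..k}"
    "definable k (qpp k S \<inter> CR k) P" "depends_only (set vs) P" by (rule qppE)
  have "definable k S P" by (rule definable_qpp_idem[OF definable_mono[OF R(4)]]) simp
  then show "R \<in> qpp k S" unfolding R(1) using R assms by (intro qpp_rel_on)
qed

end
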